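(* Let $p$ be a prime and let $a,b,c,x_0,x_1,x_2\in\mathbb{Z}$ with $p\nmid c$. Let $(x_n)_{n\in\mathbb{Z}}$ be the sequence satisfying $x_n=ax_{n-1}+bx_{n-2}+cx_{n-3}$ for all $n\in\mathbb{Z}$ (extended to negative indices via the recurrence), and assume it satisfies $$x_n=\sum_{i=1}^{3}c_{\lambda_i}\lambda_i^n\quad\text{for all } n\in\mathbb{Z},\qquad c_{\lambda_i}=\frac{q(\lambda_i)}{P'(\lambda_i)},$$ where $P(x)=x^3-ax^2-bx-c$, $q(x)=x_0x^2+(x_1-x_0a)x+(x_2-x_1a-x_0b)$, and $\lambda_1,\lambda_2,\lambda_3$ are the roots of $P$ in some extension of $\mathbb{Q}_p$. Suppose that $P$ is irreducible over $\mathbb{Q}$ and that $p$ divides neither the discriminant of $P$ nor $c$. Let $\mathcal{Z}$ be the set of twisted integral zeros of $(x_n)$ and $N_{p^k}$ the order of $\langle\lambda_1,\lambda_2,\lambda_3\rangle$ in $(\mathcal{O}/p^k)^\times$ (see context). Then: \begin{enumerate} \item If $p=2$: if there exists $\ell\in\{0,1,\dots,N_{p^2}-1\}$ such that $p^2\mid x_\ell$, $x_{\ell+N_{p^2}}-x_\ell\not\equiv 0\pmod{p^3}$, and $$\ell-\frac{x_\ell}{p^2}\left(\frac{x_{\ell+N_{p^2}}-x_\ell}{p^2}\right)^{-1}N_{p^2}\not\equiv r\pmod{p}\quad\text{for all } r\in\mathcal{Z},$$ then the Marques–Lengyel conjecture (see context) does not hold for $(x_n)$ and $p$. \item If $p\neq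 2$: if there exists $\ell\in\{0,1,\dots,N_{p}-1\}$ such that $p\mid x_\ell$, $x_{\ell+N_{p}}-x_\ell\not\equiv 0\pmod{p^2}$, and $$\ell-\frac{x_\ell}{p}\left(\frac{x_{\ell+N_{p}}-x_\ell}{p}\right)^{-1}N_{p}\not\equiv r\pmod{p}\quad\text{for all } r\in\mathcal{Z},$$ then the Marques–Lengyel conjecture does not hold for $(x_n)$ and $p$. \end{enumerate} Here the inverse is taken modulo $p$ (the quantity $(x_{\ell+N}-x_\ell)/p^k$ is an integer prime to $p$).
   Context: $\mathbb{K}=\mathbb{Q}_p(\lambda_1,\lambda_2,\lambda_3)$ is the splitting field of $P$ over $\mathbb{Q}_p$ and $\mathcal{O}$ its ring of integers; since $p\nmid c$ and $p$ does not divide the discriminant, $\lambda_i\in\mathcal{O}^\times$. For $k\ge1$, $N_{p^k}$ denotes the order of the subgroup generated by $\lambda_1,\lambda_2,\lambda_3$ in the multiplicative group $(\mathcal{O}/p^k\mathcal{O})^\times$. The set $\mathcal{Z}$ of twisted integral zeros of $(x_n)$ is the set of integers $n$ such that $\sum_{i=1}^3\xi_i c_{\lambda_i}\lambda_i^n=0$ for some roots of unity $\xi_1,\xi_2,\xi_3$. For a nonzero rational $r$, $\nu_p(r)$ is the exponent of $p$ in $r$, and $\nu_p(0)=\infty$. The Marques–Lengyel conjecture holds for $(x_n)$ and $p$ if there is a positive integer $Q$ such that for every $i\in\{0,1,\dots,Q-1\}$ one of the following holds: (C) there is $\kappa_i\in\mathbb{Z}_{\ge0}$ such that $\nu_p(x_n)=\kappa_i$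 for all but finitely many $n\in\mathbb{Z}$ with $n\equiv i\pmod Q$; or (L) there exist $a_i\in\mathbb{Z}$, $\kappa_i\in\mathbb{Z}$, $\mu_i\in\mathbb{Z}_{>0}$ with $\nu_p(a_i-i)\ge\nu_p(Q)$ such that $\nu_p(x_n)=\kappa_i+\mu_i\nu_p(n-a_i)$ for all but finitely many $n\in\mathbb{Z}$ with $n\equiv i\pmod Q$. *)

theory Defs
  imports
    "HOL-Library.Extended_Real"
    "HOL-Computational_Algebra.Computational_Algebra"
    "HOL-Number_Theory.Number_Theory"
    "HOL-Algebra.Algebra"
    "HOL-Algebra.Algebraic_Closure_Type"
    "Subresultants.Resultant_Prelim"
begin

text \<open>The valuation \<open>\<nu>\<^sub>p\<close> on the rationals, with \<open>\<nu>\<^sub>p(0) = \<infinity>\<close>.\<close>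

definition padic_val :: "nat \<Rightarrow> rat \<Rightarrow> ereal" where
  "padic_val p r =
     (if r = 0 then \<infinity>
      else ereal (real (multiplicity (int p) (fst (quotient_of r)))
                - real (multiplicity (int p) (snd (quotient_of r)))))"

text \<open>
  \<open>\<rat>\<^sub>p\<close> is the completion of \<open>\<rat>\<close> with respect to \<open>\<nu>\<^sub>p\<close>: the ring of Cauchy sequences of
  rationals modulo the ideal of null sequences. \<open>\<int>\<^sub>p\<close> is its closed unit ball.
\<close>

definition padic_cauchy :: "nat \<Rightarrow> (nat \<Rightarrow> rat) set" where
  "padic_cauchy p = {s. \<forall>k::nat. \<exists>M. \<forall>m\<ge>M. \<forall>n\<ge>M. padic_val p (s m - s n) \<ge> ereal (real k)}"

definition padic_null :: "nat \<Rightarrow> (nat \<Rightarrow> rat) set" where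
  "padic_null p = {s. \<forall>k::nat. \<exists>M. \<forall>n\<ge>M. padic_val p (s n) \<ge> ereal (real k)}"

definition padic_cauchy_ring :: "nat \<Rightarrow> (nat \<Rightarrow> rat) ring" where
  "padic_cauchy_ring p =
     \<lparr>carrier = padic_cauchy p,
      monoid.mult = (\<lambda>s t n. s n * t n), monoid.one = (\<lambda>n. 1),
      ring.zero = (\<lambda>n. 0), ring.add = (\<lambda>s t n. s n + t n)\<rparr>"

definition padic_field :: "nat \<Rightarrow> (nat \<Rightarrow> rat) set ring" where
  "padic_field p = padic_cauchy_ring p Quot padic_null p"

definition padic_integers :: "nat \<Rightarrow> (nat \<Rightarrow> rat) set set" where
  "padic_integers p = {z \<in> carrier (padic_field p). \<exists>s\<in>z. \<forall>n. padic_val p (s n) \<ge> 0}"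

text \<open>
  An extension \<open>L\<close> of \<open>\<rat>\<^sub>p\<close> is a field type \<open>'l\<close> together with a ring homomorphism \<open>\<iota>\<close> from
  \<open>\<rat>\<^sub>p\<close> to it (necessarily injective).
\<close>

definition padic_embedding :: "nat \<Rightarrow> ((nat \<Rightarrow> rat) set \<Rightarrow> 'l::field) \<Rightarrow> bool" where
  "padic_embedding p \<iota> \<longleftrightarrow> \<iota> \<in> Ring.ring_hom (padic_field p) (ring_of_type_algebra :: 'l ring)"

definition padic_adjoin :: "nat \<Rightarrow> ((nat \<Rightarrow> rat) set \<Rightarrow> 'l::field) \<Rightarrow> 'l set \<Rightarrow> 'l set" where
  "padic_adjoin p \<iota> S =
     generate_field (ring_of_type_algebra :: 'l ring) (\<iota> ` carrier (padic_field p) \<union> S)"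

text \<open>The ring of integers of a subfield \<open>K\<close> of \<open>L\<close>: the integral closure of \<open>\<int>\<^sub>p\<close> in \<open>K\<close>.\<close>

definition ring_of_integers ::
    "nat \<Rightarrow> ((nat \<Rightarrow> rat) set \<Rightarrow> 'l::field) \<Rightarrow> 'l set \<Rightarrow> 'l ring" where
  "ring_of_integers p \<iota> K =
     ring_of_type_algebra\<lparr>carrier :=
       {z \<in> K. \<exists>f :: 'l poly. lead_coeff f = 1 \<and>
          (\<forall>i. poly.coeff f i \<in> \<iota> ` padic_integers p) \<and> poly f z = 0}\<rparr>"

text \<open>
  The order of the subgroup generated by \<open>S\<close> in \<open>(\<O>/p\<^sup>k\<O>)\<^sup>\<times>\<close>, where \<open>\<O>\<close> is the ring of integers of
  \<open>\<rat>\<^sub>p(S)\<close>.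
\<close>

definition residue_order ::
    "nat \<Rightarrow> ((nat \<Rightarrow> rat) set \<Rightarrow> 'l::field) \<Rightarrow> 'l set \<Rightarrow> nat \<Rightarrow> nat" where
  "residue_order p \<iota> S k =
     (let R = ring_of_integers p \<iota> (padic_adjoin p \<iota> S);
          I = PIdl\<^bsub>R\<^esub> (of_nat (p ^ k))
      in card (generate (units_of (R Quot I)) ((\<lambda>z. I +>\<^bsub>R\<^esub> z) ` S)))"

definition poly_discriminant :: "int poly \<Rightarrow> int" where
  "poly_discriminant f =
     (let n = Polynomial.degree f
      in (-1) ^ (n * (n - 1) div 2) * resultant f (pderiv f) div lead_coeff f)"

definition char_poly3 :: "int \<Rightarrow> int \<Rightarrow> int \<Rightarrow> int poly" where
  "char_poly3 a b c = [:-c, -b, -a, 1:]"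

definition init_poly3 :: "int \<Rightarrow> int \<Rightarrow> int \<Rightarrow> int \<Rightarrow> int \<Rightarrow> int poly" where
  "init_poly3 a b x0 x1 x2 = [:x2 - x1 * a - x0 * b, x1 - x0 * a, x0:]"

text \<open>The coefficient \<open>c\<^sub>\<lambda> = q(\<lambda>)/P'(\<lambda>)\<close>.\<close>

definition binet_coeff ::
    "int \<Rightarrow> int \<Rightarrow> int \<Rightarrow> int \<Rightarrow> int \<Rightarrow> int \<Rightarrow> 'l::field \<Rightarrow> 'l" where
  "binet_coeff a b c x0 x1 x2 z =
     poly (of_int_poly (init_poly3 a b x0 x1 x2)) z
     / poly (pderiv (of_int_poly (char_poly3 a b c))) z"

text \<open>
  The twisted integral zeros of \<open>n \<mapsto> \<Sum>\<^sub>i C\<^sub>i \<lambda>\<^sub>i\<^sup>n\<close>. The roots of unity need not lie in the field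
  containing the \<open>\<lambda>\<^sub>i\<close>, so they are taken in its algebraic closure.
\<close>

definition twisted_zeros :: "(nat \<Rightarrow> 'l::field) \<Rightarrow> (nat \<Rightarrow> 'l) \<Rightarrow> int set" where
  "twisted_zeros C lam =
     {n. \<exists>\<xi> :: nat \<Rightarrow> 'l alg_closure.
           (\<forall>i\<in>{1..3}. \<exists>m>0. \<xi> i ^ m = 1) \<and>
           (\<Sum>i=1..3. \<xi> i * to_ac (C i) * to_ac (lam i) powi n) = 0}"

definition marques_lengyel :: "nat \<Rightarrow> (int \<Rightarrow> rat) \<Rightarrow> bool" where
  "marques_lengyel p x \<longleftrightarrow>
     (\<exists>Q::int. Q > 0 \<and> (\<forall>i\<in>{0..<Q}.
        (\<exists>\<kappa>::nat. finite {n. [n = i] (mod Q) \<and> padic_val p (x n) \<noteq> ereal (real \<kappa>)}) \<or>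
        (\<exists>(\<alpha>::int) (\<kappa>::int) (\<mu>::int). \<mu> > 0 \<and>
           padic_val p (of_int (\<alpha> - i)) \<ge> padic_val p (of_int Q) \<and>
           finite {n. [n = i] (mod Q) \<and>
             padic_val p (x n) \<noteq>
               ereal (real_of_int \<kappa>) + ereal (real_of_int \<mu>) * padic_val p (of_int (n - \<alpha>))})))"

text \<open>
  Terms of nonnegative index are integers, so taking the floor of such a term merely changes
  its type from \<open>rat\<close> to \<open>int\<close>.
\<close>

lemma recurrence_nonneg_integral:
  fixes a b c x0 x1 x2 :: int and x :: "int \<Rightarrow> rat" and n :: int
  assumes "\<And>n. x n = of_int a * x (n - 1) + of_int b * x (n - 2) + of_int c * x (n - 3)"
    and "x 0 = of_int x0" "x 1 = of_int x1" "x 2 = of_int x2" and "n \<ge> 0"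
  shows "of_int \<lfloor>x n\<rfloor> = x n"
proof -
  have "x (int m) \<in> \<int>" for m
  proof (induction m rule: less_induct)
    case (less m)
    show ?case
    proof (cases "m < 3")
      case True
      then consider "m = 0" | "m = 1" | "m = 2" by linarith
      then show ?thesis using assms(2-4) by cases auto
    next
      case False
      have "x (int m - 1) \<in> \<int>" "x (int m - 2) \<in> \<int>" "x (int m - 3) \<in> \<int>"
        using less.IH[of "m - 1"] less.IH[of "m - 2"] less.IH[of "m - 3"] False
        by (simp_all add: of_nat_diff)
      then show ?thesis by (subst assms(1)) auto
    qed
  qed
  from this[of "nat n"] \<open>n \<ge> 0\<close> show ?thesis by (auto elim!: Ints_cases)
qed

end

theory Submission
  imports Defs
begin

text \<open>
  Put \<open>k = 2\<close> if \<open>p = 2\<close> and \<open>k = 1\<close> otherwise, and \<open>N = N\<^bsub>p\<^sup>k\<^esub>\<close>. Since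
  \<open>\<lambda>\<^sub>i\<^sup>N \<in> 1 + p\<^sup>k\<O>\<close>, the terms satisfy
  \<open>x (l + N (t + s)) - x (l + N t) \<equiv> s (x (l + N) - x l)\<close> modulo \<open>p ^ (k + m + 1)\<close> whenever
  \<open>p\<^sup>m\<close> divides \<open>s\<close>, and Newton's method yields indices \<open>n \<equiv> l\<close> (mod \<open>N\<close>) at which \<open>x n\<close> is
  divisible by any given power of \<open>p\<close>. If the conjecture held, these indices would converge
  \<open>p\<close>-adically to an integer \<open>\<alpha>\<close>, which is congruent mod \<open>p\<close> to the number in the hypothesis. But
  \<open>\<lambda>\<^sub>i ^ (n - \<alpha>)\<close> then has an \<open>N\<close>-th power close to 1, so it is close to an \<open>N\<close>-th root of unity
  \<open>\<xi>\<^sub>i\<close>, and in the limit \<open>\<Sum>\<^sub>i \<xi>\<^sub>i c\<^sub>i \<lambda>\<^sub>i\<^sup>\<alpha> = 0\<close>: \<open>\<alpha>\<close> is a twisted zero.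

  No completeness is needed. All congruences take place in a valuation ring of the algebraic closure
  that contains the image of \<open>\<int>\<^sub>p\<close> but not \<open>1/p\<close>; an element integral over \<open>\<int>\<^sub>p\<close> that all powers
  of \<open>p\<close> divide there is zero, because these powers then also divide the constant term of a minimal
  equation for it, and that term lies in \<open>\<int>\<^sub>p\<close>.
\<close>

section \<open>Valuation rings and integral closure\<close>

definition unital_subring :: "'a::comm_ring_1 set \<Rightarrow> bool" where
  "unital_subring S \<longleftrightarrow> 1 \<in> S \<and> (\<forall>x\<in>S. \<forall>y\<in>S. x - y \<in> S \<and> x * y \<in> S)"

text \<open>The same monic-equation condition as in \<open>ring_of_integers\<close>, so the carrier
  there is a subfield intersected with an integral closure.\<close>

definition integral_over :: "'a::comm_ring_1 set \<Rightarrow> 'a \<Rightarrow> bool" where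
  "integral_over B z \<longleftrightarrow>
     (\<exists>f. lead_coeff f = 1 \<and> (\<forall>i. poly.coeff f i \<in> B) \<and> poly f z = 0)"

text \<open>The whole field also qualifies; properness is always obtained from a separate condition
  of the form \<open>inverse w \<notin> A\<close>.\<close>

definition valuation_subring :: "'a::field set \<Rightarrow> bool" where
  "valuation_subring A \<longleftrightarrow> unital_subring A \<and> (\<forall>z. z \<in> A \<or> inverse z \<in> A)"

definition adjoin :: "'a::comm_ring_1 set \<Rightarrow> 'a \<Rightarrow> 'a set" where
  "adjoin B z = {poly f z |f. \<forall>i. poly.coeff f i \<in> B}"

lemma unital_subringD:
  assumes "unital_subring S"
  shows "0 \<in> S" "1 \<in> S"
    "\<And>x y. x \<in> S \<Longrightarrow> y \<in> S \<Longrightarrow> x - y \<in> S"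
    "\<And>x. x \<in> S \<Longrightarrow> - x \<in> S"
    "\<And>x y. x \<in> S \<Longrightarrow> y \<in> S \<Longrightarrow> x + y \<in> S"
    "\<And>x y. x \<in> S \<Longrightarrow> y \<in> S \<Longrightarrow> x * y \<in> S"
proof -
  show 1: "1 \<in> S" and d: "\<And>x y. x \<in> S \<Longrightarrow> y \<in> S \<Longrightarrow> x - y \<in> S"
    and "\<And>x y. x \<in> S \<Longrightarrow> y \<in> S \<Longrightarrow> x * y \<in> S"
    using assms by (auto simp: unital_subring_def)
  show 0: "0 \<in> S" using d[OF 1 1] by simp
  show m: "- x \<in> S" if "x \<in> S" for x using d[OF 0 that] by simp
  show "x + y \<in> S" if "x \<in> S" "y \<in> S" for x y using d[OF that(1) m[OF that(2)]] by simp
qed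

lemma unital_subring_power:
  assumes "unital_subring S" "x \<in> S"
  shows "x ^ n \<in> S"
  by (induction n) (use assms unital_subringD in auto)

lemma unital_subring_sum:
  assumes "unital_subring S" "\<And>i. i \<in> I \<Longrightarrow> f i \<in> S"
  shows "sum f I \<in> S"
  using assms(2) by (induction I rule: infinite_finite_induct) (use unital_subringD[OF assms(1)] in auto)

lemma unital_subring_of_nat:
  assumes "unital_subring S"
  shows "of_nat n \<in> S"
  by (induction n) (use unital_subringD[OF assms] in auto)

lemma unital_subring_of_int:
  assumes "unital_subring S"
  shows "of_int n \<in> S"
  by (cases n) (use unital_subringD[OF assms] unital_subring_of_nat[OF assms] in
      \<open>auto simp del: of_nat_Suc\<close>)

lemma unital_subring_poly:
  assumes "unital_subring S" "\<And>i. poly.coeff f i \<in> S" "x \<in> S"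
  shows "poly f x \<in> S"
  unfolding poly_altdef
  by (intro unital_subring_sum unital_subringD unital_subring_power assms)

lemma unital_subring_powi:
  fixes x :: "'a::field"
  assumes "unital_subring S" "x \<in> S" "inverse x \<in> S"
  shows "x powi n \<in> S"
  using assms by (auto simp: power_int_def intro!: unital_subring_power)

lemma coeff_mult_in_subring:
  assumes "unital_subring B" "\<And>i. poly.coeff f i \<in> B" "\<And>i. poly.coeff g i \<in> B"
  shows "poly.coeff (f * g) i \<in> B"
  unfolding coeff_mult by (intro unital_subring_sum unital_subringD assms)

lemma unital_subring_adjoin:
  assumes "unital_subring B"
  shows "unital_subring (adjoin B z)"
  unfolding unital_subring_def
proof (intro conjI ballI)
  show "1 \<in> adjoin B z" unfolding adjoin_def
    by (rule CollectI, rule exI[of _ 1]) (auto simp: unital_subringD[OF assms])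
next
  fix x y assume "x \<in> adjoin B z" "y \<in> adjoin B z"
  then obtain f g where fg: "x = poly f z" "y = poly g z"
    "\<And>i. poly.coeff f i \<in> B" "\<And>i. poly.coeff g i \<in> B"
    unfolding adjoin_def by auto
  show "x - y \<in> adjoin B z" unfolding adjoin_def
    by (rule CollectI, rule exI[of _ "f - g"]) (auto simp: fg unital_subringD[OF assms])
  show "x * y \<in> adjoin B z" unfolding adjoin_def
    by (rule CollectI, rule exI[of _ "f * g"])
      (use fg coeff_mult_in_subring[OF assms fg(3,4)] in auto)
qed

lemma subset_adjoin:
  assumes "unital_subring B"
  shows "B \<subseteq> adjoin B z"
proof
  fix b assume "b \<in> B"
  then show "b \<in> adjoin B z" unfolding adjoin_def
    by (intro CollectI exI[of _ "[:b:]"])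
       (auto simp: unital_subringD[OF assms] coeff_pCons split: nat.split)
qed

lemma self_in_adjoin:
  assumes "unital_subring B"
  shows "z \<in> adjoin B z"
  unfolding adjoin_def
  by (intro CollectI exI[of _ "[:0, 1:]"])
     (auto simp: unital_subringD[OF assms] coeff_pCons split: nat.split)

section \<open>Chevalley's extension theorem\<close>

definition bounded_adjoin :: "'a::comm_ring_1 set \<Rightarrow> nat \<Rightarrow> 'a \<Rightarrow> 'a set" where
  "bounded_adjoin A n z = {\<Sum>j\<le>n. a j * z ^ j |a. \<forall>j. a j \<in> A}"

lemma bounded_adjoinI: "(\<And>j. a j \<in> A) \<Longrightarrow> (\<Sum>j\<le>n. a j * z ^ j) \<in> bounded_adjoin A n z"
  unfolding bounded_adjoin_def by auto

lemma adjoin_imp_bounded_adjoin: "y \<in> adjoin A z \<Longrightarrow> \<exists>n. y \<in> bounded_adjoin A n z"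
  unfolding adjoin_def bounded_adjoin_def by (auto simp: poly_altdef)

lemma bounded_adjoin_add:
  assumes "unital_subring A" "x \<in> bounded_adjoin A n z" "y \<in> bounded_adjoin A n z"
  shows "x + y \<in> bounded_adjoin A n z"
proof -
  obtain a b where ab: "x = (\<Sum>j\<le>n. a j * z ^ j)" "y = (\<Sum>j\<le>n. b j * z ^ j)"
    "\<And>j. a j \<in> A" "\<And>j. b j \<in> A"
    using assms(2,3) unfolding bounded_adjoin_def by auto
  have "x + y = (\<Sum>j\<le>n. (a j + b j) * z ^ j)"
    unfolding ab by (simp add: sum.distrib algebra_simps)
  then show ?thesis using bounded_adjoinI[of "\<lambda>j. a j + b j"] ab unital_subringD(5)[OF assms(1)]
    by simp
qed

lemma bounded_adjoin_monom:
  assumes "unital_subring A" "a \<in> A" "j \<le> n"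
  shows "a * z ^ j \<in> bounded_adjoin A n z"
proof -
  have "(\<Sum>i\<le>n. (if i = j then a else 0) * z ^ i) = a * z ^ j"
    using assms(3) by (simp add: if_distrib[of "\<lambda>x. x * _"] sum.delta' cong: if_cong)
  then show ?thesis
    using bounded_adjoinI[where a = "\<lambda>i. if i = j then a else 0" and A = A and n = n and z = z] assms(2) unital_subringD(1)[OF assms(1)]
    by simp
qed

lemma bounded_adjoin_sum:
  assumes "unital_subring A" "\<And>i. i \<in> I \<Longrightarrow> f i \<in> bounded_adjoin A n z"
  shows "sum f I \<in> bounded_adjoin A n z"
proof -
  have "0 \<in> bounded_adjoin A n z"
    using bounded_adjoin_monom[OF assms(1), of 0 0 n z] unital_subringD(1)[OF assms(1)] by simp
  then show ?thesis using assms(2)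
    by (induction I rule: infinite_finite_induct) (auto intro: bounded_adjoin_add[OF assms(1)])
qed

text \<open>
  As in Chevalley's extension theorem, relations of minimal degree for \<open>z\<close> and \<open>1/z\<close> can be
  combined to lower the larger degree; hence one of \<open>z\<close>, \<open>1/z\<close> satisfies no relation.
\<close>

lemma bounded_adjoin_reduce:
  fixes z :: "'a::field"
  assumes A: "unital_subring A" and w: "w \<in> A" "w \<noteq> 0"
    and units: "\<And>b. b \<in> A \<Longrightarrow> inverse (1 - w * b) \<in> A \<and> 1 - w * b \<noteq> 0"
    and n: "inverse w \<in> bounded_adjoin A (Suc n) z"
    and m: "inverse w \<in> bounded_adjoin A m (inverse z)"
    and "m \<le> Suc n" and z: "z \<noteq> 0"
  shows "inverse w \<in> bounded_adjoin A n z"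
proof -
  obtain a where a: "inverse w = (\<Sum>j\<le>Suc n. a j * z ^ j)" "\<And>j. a j \<in> A"
    using n unfolding bounded_adjoin_def by blast
  obtain b where b: "inverse w = (\<Sum>j\<le>m. b j * inverse z ^ j)" "\<And>j. b j \<in> A"
    using m unfolding bounded_adjoin_def by blast
  define e where "e = inverse (1 - w * b 0)"
  have e: "e \<in> A" "e * (1 - w * b 0) = 1" using units[OF b(2)[of 0]] by (auto simp: e_def)
  \<comment> \<open>Multiplying the relation in powers of 1/z by w isolates its constant term. Since
    \<open>1 - w * b 0\<close> is a unit of A, dividing by it writes 1 as a combination of the
    powers of 1/z with exponents from 1 to m.\<close>
  have "1 - w * b 0 = w * (\<Sum>j\<in>{1..m}. b j * inverse z ^ j)"
  proof -
    have "{..m} = insert 0 {1..m}" by auto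
    then have "inverse w = b 0 + (\<Sum>j\<in>{1..m}. b j * inverse z ^ j)" using b(1) by simp
    then have "w * inverse w = w * (b 0 + (\<Sum>j\<in>{1..m}. b j * inverse z ^ j))" by simp
    then show ?thesis using w(2) by (simp add: algebra_simps)
  qed
  then have one: "1 = w * e * (\<Sum>j\<in>{1..m}. b j * inverse z ^ j)"
    using e(2) by (metis mult.assoc mult.commute)
  \<comment> \<open>Multiply that expression of 1 by \<open>z ^ Suc n\<close>: exponents stay
    nonnegative because \<open>m \<le> Suc n\<close>, and drop below \<open>Suc n\<close> because
    each j is at least 1. The top term of the relation in z can thus be rewritten in lower
    degree.\<close>
  have "z ^ Suc n = (\<Sum>j\<in>{1..m}. w * e * b j * (z ^ Suc n * inverse z ^ j))"
  proof -
    have "z ^ Suc n * (w * e * (\<Sum>j\<in>{1..m}. b j * inverse z ^ j))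
        = (\<Sum>j\<in>{1..m}. w * e * b j * (z ^ Suc n * inverse z ^ j))"
      by (simp add: sum_distrib_left mult_ac)
    then show ?thesis using one by (metis mult.right_neutral)
  qed
  also have "\<dots> = (\<Sum>j\<in>{1..m}. w * e * b j * z ^ (Suc n - j))"
  proof (rule sum.cong)
    fix j assume "j \<in> {1..m}"
    then have "j \<le> Suc n" using \<open>m \<le> Suc n\<close> by auto
    then have "z ^ Suc n * inverse z ^ j = z ^ (Suc n - j)"
      using z by (simp add: power_diff field_simps)
    then show "w * e * b j * (z ^ Suc n * inverse z ^ j) = w * e * b j * z ^ (Suc n - j)" by simp
  qed simp
  finally have top: "z ^ Suc n = (\<Sum>j\<in>{1..m}. w * e * b j * z ^ (Suc n - j))" .
  have "a (Suc n) * z ^ Suc n = (\<Sum>j\<in>{1..m}. a (Suc n) * w * e * b j * z ^ (Suc n - j))"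
    unfolding top sum_distrib_left by (simp add: mult.assoc)
  also have "\<dots> \<in> bounded_adjoin A n z"
    by (intro bounded_adjoin_sum bounded_adjoin_monom A unital_subringD(6)[OF A] a b w e) auto
  finally have "a (Suc n) * z ^ Suc n \<in> bounded_adjoin A n z" .
  moreover have "(\<Sum>j\<le>n. a j * z ^ j) \<in> bounded_adjoin A n z"
    by (intro bounded_adjoinI a)
  ultimately have "(\<Sum>j\<le>n. a j * z ^ j) + a (Suc n) * z ^ Suc n \<in> bounded_adjoin A n z"
    by (rule bounded_adjoin_add[OF A, rotated])
  then show ?thesis unfolding a(1) by simp
qed

text \<open>If neither z nor 1/z lies in A, maximality puts 1/w into both A[z] and A[1/z]. Among
  expressions of least degree, the one of larger degree can be shortened by
  \<open>bounded_adjoin_reduce\<close>, a contradiction. That reduction requires every 1 - w b to be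
  a unit, which maximality also yields.\<close>

lemma maximal_subring_valuation:
  fixes w :: "'a::field"
  assumes A: "unital_subring A" and w: "w \<in> A" and notin: "inverse w \<notin> A"
    and max: "\<And>A'. unital_subring A' \<Longrightarrow> A \<subseteq> A' \<Longrightarrow> inverse w \<notin> A' \<Longrightarrow> A' = A"
  shows "valuation_subring A"
proof -
  have w0: "w \<noteq> 0" using notin unital_subringD(1)[OF A] by auto
  have adj: "inverse w \<in> adjoin A z" if "z \<notin> A" for z
    using max[OF unital_subring_adjoin[OF A] subset_adjoin[OF A], of z] self_in_adjoin[OF A, of z] that
    by auto
  have units: "inverse (1 - w * b) \<in> A \<and> 1 - w * b \<noteq> 0" if b: "b \<in> A" for b
  proof
    show nz: "1 - w * b \<noteq> 0"
    proof
      assume "1 - w * b = 0"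
      then have "inverse w = b" using w0 by (simp add: field_simps)
      then show False using notin b by simp
    qed
    show "inverse (1 - w * b) \<in> A"
    proof (rule ccontr)
      define d where "d = 1 - w * b"
      assume "inverse (1 - w * b) \<notin> A"
      then obtain n a where a: "inverse w = (\<Sum>j\<le>n. a j * inverse d ^ j)" "\<And>j. a j \<in> A"
        using adjoin_imp_bounded_adjoin[OF adj] unfolding bounded_adjoin_def d_def by blast
      have d: "d \<in> A" "d \<noteq> 0" using b w nz unital_subringD[OF A] by (auto simp: d_def)
      \<comment> \<open>If 1/d were missing from A, then 1/w would be a polynomial in 1/d. Clearing
        denominators gives \<open>d ^ n * inverse w \<in> A\<close>; but d is 1 modulo w, so this
        element differs from 1/w by an element of A.\<close>
      have "d ^ n * inverse w = (\<Sum>j\<le>n. a j * (d ^ n * inverse d ^ j))"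
        unfolding a(1) sum_distrib_left by (simp add: algebra_simps)
      also have "\<dots> = (\<Sum>j\<le>n. a j * d ^ (n - j))"
        by (rule sum.cong) (use d in \<open>auto simp: power_diff field_simps\<close>)
      also have "\<dots> \<in> A"
        by (intro unital_subring_sum[OF A] unital_subringD(6)[OF A] unital_subring_power[OF A] a d)
      finally have 1: "d ^ n * inverse w \<in> A" .
      have "\<exists>c\<in>A. d ^ n = 1 - w * c"
      proof (induction n)
        case 0
        then show ?case using unital_subringD(1)[OF A] by (intro bexI[of _ 0]) auto
      next
        case (Suc n)
        then obtain c where c: "c \<in> A" "d ^ n = 1 - w * c" by auto
        have "d ^ Suc n = 1 - w * (b + c - w * b * c)"
          unfolding power_Suc c(2) unfolding d_def by (simp add: algebra_simps)
        then show ?case using b c w unital_subringD[OF A] by (intro bexI[of _ "b + c - w * b * c"]) auto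
      qed
      then obtain c where c: "c \<in> A" "d ^ n = 1 - w * c" by auto
      have "d ^ n * inverse w = inverse w - c" using w0 by (simp add: c algebra_simps)
      then have "inverse w = d ^ n * inverse w + c" by simp
      then show False using 1 c(1) notin unital_subringD(5)[OF A] by metis
    qed
  qed
  have False if z: "z \<notin> A" "inverse z \<notin> A" for z
  proof -
    have z0: "z \<noteq> 0" using z unital_subringD(1)[OF A] by auto
    define Q where "Q = (\<lambda>y n. inverse w \<in> bounded_adjoin A n y)"
    have ex: "\<exists>n. Q z n" "\<exists>n. Q (inverse z) n"
      using adjoin_imp_bounded_adjoin[OF adj] z unfolding Q_def by auto
    define n where "n = (LEAST n. Q z n)"
    define m where "m = (LEAST n. Q (inverse z) n)"
    have nm: "Q z n" "Q (inverse z) m" unfolding n_def m_def using ex by (auto intro: LeastI_ex)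
    have least: "\<not> Q z k" if "k < n" for k using that not_less_Least unfolding n_def by blast
    have least': "\<not> Q (inverse z) k" if "k < m" for k using that not_less_Least unfolding m_def by blast
    have not0: "\<not> Q y 0" for y using notin by (auto simp: Q_def bounded_adjoin_def)
    have pos: "n > 0" "m > 0" using nm not0 by (metis neq0_conv)+
    show False
    proof (cases "m \<le> n")
      case True
      then show False
        using bounded_adjoin_reduce[OF A w w0 units, of "n - 1" z m] nm pos z0 least[of "n - 1"]
        by (auto simp: Q_def)
    next
      case False
      then show False
        using bounded_adjoin_reduce[OF A w w0 units, of "m - 1" "inverse z" n] nm pos z0 least'[of "m - 1"]
        by (auto simp: Q_def)
    qed
  qed
  then show ?thesis using A unfolding valuation_subring_def by blast
qed

text \<open>Zorn's lemma for the subrings that contain B and omit the single element 1/w, a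
  condition that passes to unions of chains; a maximal one is a valuation ring.\<close>

theorem valuation_subring_exists:
  fixes w :: "'a::field"
  assumes B: "unital_subring B" and w: "w \<in> B" and notin: "inverse w \<notin> B"
  shows "\<exists>A. valuation_subring A \<and> B \<subseteq> A \<and> inverse w \<notin> A"
proof -
  let ?S = "{A. unital_subring A \<and> B \<subseteq> A \<and> inverse w \<notin> A}"
  have "\<exists>M\<in>?S. \<forall>V1\<in>?S. M \<subseteq> V1 \<longrightarrow> V1 = M"
  proof (rule subset_Zorn_nonempty)
    show "?S \<noteq> {}" using assms by blast
  next
    fix C assume C: "C \<noteq> {}" "subset.chain ?S C"
    have sub: "unital_subring A" "B \<subseteq> A" "inverse w \<notin> A" if "A \<in> C" for A
      using C(2) that unfolding subset_chain_def by auto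
    have "unital_subring (\<Union>C)"
      unfolding unital_subring_def
    proof (intro conjI ballI)
      show "1 \<in> \<Union>C" using C(1) sub(1) unital_subringD(2) by blast
    next
      fix x y assume "x \<in> \<Union>C" "y \<in> \<Union>C"
      then obtain V1 V2 where V12: "V1 \<in> C" "x \<in> V1" "V2 \<in> C" "y \<in> V2" by auto
      have "V1 \<subseteq> V2 \<or> V2 \<subseteq> V1" using C(2) V12 unfolding subset_chain_def by auto
      then obtain V where V: "V \<in> C" "x \<in> V" "y \<in> V" using V12 by auto
      show "x - y \<in> \<Union>C" "x * y \<in> \<Union>C"
        using V(1) unital_subringD(3,6)[OF sub(1)[OF V(1)] V(2,3)] by auto
    qed
    moreover obtain A0 where A0: "A0 \<in> C" using C(1) by auto
    moreover have "B \<subseteq> \<Union>C" by (rule Sup_upper2[OF A0 sub(2)[OF A0]])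
    moreover have "inverse w \<notin> \<Union>C" using sub(3) by auto
    ultimately show "\<Union>C \<in> ?S" by simp
  qed
  then obtain A where AS: "A \<in> ?S" and max': "\<forall>V1\<in>?S. A \<subseteq> V1 \<longrightarrow> V1 = A" by (elim bexE)
  have A: "unital_subring A" "B \<subseteq> A" "inverse w \<notin> A" using AS by auto
  have max: "V1 = A" if "unital_subring V1" "B \<subseteq> V1" "inverse w \<notin> V1" "A \<subseteq> V1" for V1
    using max' that by simp
  have "valuation_subring A"
  proof (rule maximal_subring_valuation)
    show "A' = A" if "unital_subring A'" "A \<subseteq> A'" "inverse w \<notin> A'" for A'
      using max[OF that(1) order.trans[OF A(2) that(2)] that(3,2)] .
  qed (use A w in auto)
  then show ?thesis using A by blast
qed

section \<open>Integral closure as an intersection of valuation rings\<close>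

text \<open>If z were outside A, then 1/z would lie in A, and a monic equation of degree k + 1
  divided by \<open>z ^ k\<close> would express z as a polynomial in 1/z over A.\<close>

lemma valuation_subring_integrally_closed:
  fixes A :: "'a::field set"
  assumes A: "valuation_subring A" and z: "integral_over A z"
  shows "z \<in> A"
proof (rule ccontr)
  assume "z \<notin> A"
  then have i: "inverse z \<in> A" and z0: "z \<noteq> 0"
    using A unfolding valuation_subring_def by (auto simp: unital_subringD(1))
  have A': "unital_subring A" using A by (simp add: valuation_subring_def)
  obtain f where f: "lead_coeff f = 1" "\<And>i. poly.coeff f i \<in> A" "poly f z = 0"
    using z unfolding integral_over_def by auto
  define n where "n = Polynomial.degree f"
  have "n \<noteq> 0"
  proof
    assume "n = 0"
    then have "poly f z = lead_coeff f" unfolding n_def poly_altdef by simp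
    then show False using f by simp
  qed
  then obtain k where k: "n = Suc k" by (cases n) auto
  have "0 = inverse z ^ k * poly f z" using f by simp
  also have "\<dots> = (\<Sum>j\<le>k. poly.coeff f j * (inverse z ^ k * z ^ j)) + inverse z ^ k * z ^ Suc k"
    using f(1) unfolding poly_altdef n_def[symmetric] k
    by (simp add: sum_distrib_left algebra_simps)
  also have "inverse z ^ k * z ^ Suc k = z" using z0 by (simp add: field_simps)
  also have "(\<Sum>j\<le>k. poly.coeff f j * (inverse z ^ k * z ^ j)) = (\<Sum>j\<le>k. poly.coeff f j * inverse z ^ (k - j))"
    by (rule sum.cong) (use z0 in \<open>auto simp: power_diff field_simps\<close>)
  finally have "z = - (\<Sum>j\<le>k. poly.coeff f j * inverse z ^ (k - j))"
    by (simp add: eq_neg_iff_add_eq_0 add.commute)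
  also have "\<dots> \<in> A"
    by (intro unital_subringD(4,6)[OF A'] unital_subring_sum[OF A'] unital_subring_power[OF A'] i f)
  finally show False using \<open>z \<notin> A\<close> by simp
qed

lemma integral_over_mono: "integral_over B z \<Longrightarrow> B \<subseteq> A \<Longrightarrow> integral_over A z"
  unfolding integral_over_def by blast

lemma integral_over_self:
  assumes "unital_subring B" "b \<in> B"
  shows "integral_over B b"
  unfolding integral_over_def
  by (rule exI[of _ "[:-b, 1:]"])
     (use assms in \<open>auto simp: unital_subringD coeff_pCons split: nat.split\<close>)

text \<open>For non-integral z put w = 1/z. A relation placing z = 1/w in B[w] would become a monic
  equation for z after clearing denominators, so z is not in B[w], and Chevalley's theorem supplies
  a valuation ring above B[w] that omits z. The criterion makes closure of integral elements under
  ring operations immediate.\<close>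

lemma integral_over_iff_valuation:
  fixes B :: "'a::field set"
  assumes B: "unital_subring B"
  shows "integral_over B z \<longleftrightarrow> (\<forall>A. valuation_subring A \<longrightarrow> B \<subseteq> A \<longrightarrow> z \<in> A)"
proof
  assume "integral_over B z"
  then show "\<forall>A. valuation_subring A \<longrightarrow> B \<subseteq> A \<longrightarrow> z \<in> A"
    using valuation_subring_integrally_closed integral_over_mono by blast
next
  assume all: "\<forall>A. valuation_subring A \<longrightarrow> B \<subseteq> A \<longrightarrow> z \<in> A"
  show "integral_over B z"
  proof (rule ccontr)
    assume not: "\<not> integral_over B z"
    have z0: "z \<noteq> 0" using not integral_over_self[OF B unital_subringD(1)[OF B]] by auto
    define w where "w = inverse z"
    have "inverse w \<notin> adjoin B w"
    proof
      assume "inverse w \<in> adjoin B w"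
      then obtain n a where a: "inverse w = (\<Sum>j\<le>n. a j * w ^ j)" "\<And>j. a j \<in> B"
        using adjoin_imp_bounded_adjoin unfolding bounded_adjoin_def by blast
      \<comment> \<open>The relation for z = 1/w, multiplied by \<open>z ^ n\<close>, reads
        \<open>z ^ Suc n = poly g z\<close>, and g has degree at most n.\<close>
      define g where "g = (\<Sum>j\<le>n. Polynomial.monom (a j) (n - j))"
      define f where "f = Polynomial.monom 1 (Suc n) - g"
      have dg: "Polynomial.degree g \<le> n" unfolding g_def
        by (intro degree_sum_le) (auto intro: order.trans[OF degree_monom_le])
      have df: "Polynomial.degree f = Suc n"
      proof (rule antisym)
        show "Polynomial.degree f \<le> Suc n" unfolding f_def
          by (intro degree_diff_le) (use dg in \<open>auto simp: degree_monom_eq\<close>)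
        show "Suc n \<le> Polynomial.degree f"
          by (rule le_degree) (use dg in \<open>auto simp: f_def coeff_eq_0\<close>)
      qed
      have "lead_coeff f = 1" unfolding df using dg by (auto simp: f_def coeff_eq_0)
      moreover have "poly.coeff f i \<in> B" for i
        unfolding f_def g_def coeff_diff coeff_sum coeff_monom
        by (intro unital_subringD(3)[OF B] unital_subring_sum[OF B]) (auto simp: unital_subringD[OF B] a)
      moreover have "poly f z = 0"
      proof -
        have "z ^ Suc n = z ^ n * inverse w" by (simp add: w_def)
        also have "\<dots> = (\<Sum>j\<le>n. a j * (z ^ n * w ^ j))"
          unfolding a(1) sum_distrib_left by (simp add: algebra_simps)
        also have "\<dots> = (\<Sum>j\<le>n. a j * z ^ (n - j))"
          by (rule sum.cong) (use z0 in \<open>auto simp: w_def power_diff field_simps\<close>)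
        also have "\<dots> = poly g z" by (simp add: g_def poly_sum poly_monom)
        finally show ?thesis by (simp add: f_def poly_monom)
      qed
      ultimately show False using not unfolding integral_over_def by blast
    qed
    then obtain A where "valuation_subring A" "adjoin B w \<subseteq> A" "inverse w \<notin> A"
      using valuation_subring_exists[OF unital_subring_adjoin[OF B] self_in_adjoin[OF B], of w] by blast
    then show False using all subset_adjoin[OF B, of w] by (auto simp: w_def)
  qed
qed

lemma unital_subring_integral_closure:
  fixes B :: "'a::field set"
  assumes "unital_subring B"
  shows "unital_subring {z. integral_over B z}"
  unfolding unital_subring_def
  by (auto simp: integral_over_iff_valuation[OF assms] valuation_subring_def unital_subringD)

section \<open>The image of the \<open>p\<close>-adic integers\<close>

text \<open>Membership of r in p^k times the localization of the integers at p, cross-multiplied so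
  that estimates involve neither reduced fractions nor extended reals.\<close>

definition pdivides_rat :: "nat \<Rightarrow> nat \<Rightarrow> rat \<Rightarrow> bool" where
  "pdivides_rat p k r \<longleftrightarrow> (\<exists>a b. \<not> int p dvd b \<and> r * of_int b = of_int (int p ^ k * a))"

lemma pdivides_rat_of_int:
  assumes "Factorial_Ring.prime p"
  shows "pdivides_rat p k (of_int y) \<longleftrightarrow> int p ^ k dvd y"
proof
  assume "pdivides_rat p k (of_int y)"
  then obtain a b where ab: "\<not> int p dvd b" "(of_int y :: rat) * of_int b = of_int (int p ^ k * a)"
    unfolding pdivides_rat_def by blast
  then have "y * b = int p ^ k * a" by (metis of_int_eq_iff of_int_mult)
  moreover have "coprime (int p ^ k) b"
    using assms ab(1) by (simp add: prime_imp_coprime)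
  ultimately show "int p ^ k dvd y" by (metis coprime_dvd_mult_left_iff dvd_triv_left)
next
  assume "int p ^ k dvd y"
  then obtain a where "y = int p ^ k * a" by blast
  moreover have "\<not> int p dvd 1" using assms by (simp add: prime_nat_iff)
  ultimately show "pdivides_rat p k (of_int y)" unfolding pdivides_rat_def
    by (intro exI[of _ a] exI[of _ 1]) simp
qed

lemma padic_val_ge_iff:
  assumes p: "Factorial_Ring.prime p"
  shows "padic_val p r \<ge> ereal (real k) \<longleftrightarrow> pdivides_rat p k r"
proof (cases "r = 0")
  case True
  then show ?thesis using pdivides_rat_of_int[OF p, of k 0] by (simp add: padic_val_def)
next
  case False
  have pp: "Factorial_Ring.prime (int p)" using p by simp
  obtain n d where q: "quotient_of r = (n, d)" by fastforce
  have r: "r = of_int n / of_int d" and d: "d > 0" and cop: "coprime n d"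
    using q by (auto simp: quotient_of_div quotient_of_denom_pos quotient_of_coprime)
  have n: "n \<noteq> 0" using False r by auto
  have val: "padic_val p r \<ge> ereal (real k) \<longleftrightarrow>
      multiplicity (int p) n \<ge> k + multiplicity (int p) d"
    using False q by (auto simp: padic_val_def)
  show ?thesis unfolding val
  proof
    assume ge: "k + multiplicity (int p) d \<le> multiplicity (int p) n"
    \<comment> \<open>A factor p of the denominator would, by the inequality of multiplicities, also
      divide the numerator, although the fraction is reduced.\<close>
    have nd: "\<not> int p dvd d"
    proof
      assume dd: "int p dvd d"
      then have "multiplicity (int p) d > 0"
        using d pp by (simp add: prime_multiplicity_gt_zero_iff)
      then have "multiplicity (int p) n > 0" using ge by linarith
      then have "int p dvd n" using n pp by (simp add: prime_multiplicity_gt_zero_iff)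
      then show False using dd cop pp by (meson coprime_common_divisor not_prime_unit)
    qed
    have "int p ^ k dvd n"
      using ge multiplicity_dvd'[of k "int p" n] by simp
    then obtain a where "n = int p ^ k * a" by blast
    then show "pdivides_rat p k r" unfolding pdivides_rat_def using nd d
      by (intro exI[of _ a] exI[of _ d]) (simp add: r)
  next
    assume "pdivides_rat p k r"
    then obtain a b where ab: "\<not> int p dvd b" "r * of_int b = of_int (int p ^ k * a)"
      unfolding pdivides_rat_def by blast
    then have "(of_int (n * b) :: rat) = of_int (int p ^ k * a * d)"
      using d by (simp add: r field_simps)
    then have eq: "n * b = int p ^ k * a * d" by (simp only: of_int_eq_iff)
    have b0: "b \<noteq> 0" using ab by auto
    then have a0: "a \<noteq> 0" using eq n by auto
    have "multiplicity (int p) (n * b) = multiplicity (int p) n"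
      using pp n b0 ab(1) by (simp add: prime_elem_multiplicity_mult_distrib not_dvd_imp_multiplicity_0)
    moreover have "multiplicity (int p) (int p ^ k * a * d) = k + multiplicity (int p) a + multiplicity (int p) d"
      using pp a0 d by (simp add: prime_elem_multiplicity_mult_distrib multiplicity_same_power)
    ultimately show "k + multiplicity (int p) d \<le> multiplicity (int p) n" using eq by simp
  qed
qed

context
  fixes p :: nat
  assumes p: "Factorial_Ring.prime p"
begin

lemma pdivides_rat_add:
  assumes "pdivides_rat p k r" "pdivides_rat p k s"
  shows "pdivides_rat p k (r + s)"
proof -
  obtain a b c d where *: "\<not> int p dvd b" "r * of_int b = of_int (int p ^ k * a)"
    "\<not> int p dvd d" "s * of_int d = of_int (int p ^ k * c)"
    using assms unfolding pdivides_rat_def by blast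
  have "(r + s) * of_int (b * d) = r * of_int b * of_int d + s * of_int d * of_int b"
    by (simp add: algebra_simps)
  also have "\<dots> = of_int (int p ^ k * (a * d + c * b))"
    unfolding * by (simp add: algebra_simps)
  finally have "(r + s) * of_int (b * d) = of_int (int p ^ k * (a * d + c * b))" .
  moreover have "\<not> int p dvd b * d" using * p by (simp add: prime_dvd_mult_iff)
  ultimately show ?thesis unfolding pdivides_rat_def by blast
qed

lemma pdivides_rat_mult:
  assumes "pdivides_rat p j r" "pdivides_rat p k s"
  shows "pdivides_rat p (j + k) (r * s)"
proof -
  obtain a b c d where *: "\<not> int p dvd b" "r * of_int b = of_int (int p ^ j * a)"
    "\<not> int p dvd d" "s * of_int d = of_int (int p ^ k * c)"
    using assms unfolding pdivides_rat_def by blast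
  have "(r * s) * of_int (b * d) = (r * of_int b) * (s * of_int d)"
    by (simp add: algebra_simps)
  also have "\<dots> = of_int (int p ^ (j + k) * (a * c))"
    unfolding * by (simp add: algebra_simps power_add)
  finally have "(r * s) * of_int (b * d) = of_int (int p ^ (j + k) * (a * c))" .
  moreover have "\<not> int p dvd b * d" using * p by (simp add: prime_dvd_mult_iff)
  ultimately show ?thesis unfolding pdivides_rat_def by blast
qed

lemma pdivides_rat_mult0:
  "pdivides_rat p 0 r \<Longrightarrow> pdivides_rat p k s \<Longrightarrow> pdivides_rat p k (r * s)"
  using pdivides_rat_mult[of 0 r k s] by simp

lemma pdivides_rat_uminus: "pdivides_rat p k r \<Longrightarrow> pdivides_rat p k (- r)"
  using pdivides_rat_mult0[of "-1" k r] pdivides_rat_of_int[OF p, of 0 "-1"] by simp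

lemma pdivides_rat_diff:
  "pdivides_rat p k r \<Longrightarrow> pdivides_rat p k s \<Longrightarrow> pdivides_rat p k (r - s)"
  using pdivides_rat_add[of k r "- s"] pdivides_rat_uminus[of k s] by simp

lemma pdivides_rat_0 [simp]: "pdivides_rat p k 0"
  using pdivides_rat_of_int[OF p, of k 0] by simp

lemma pdivides_rat_cancel:
  "pdivides_rat p (k + j) (of_nat p ^ j * r) \<longleftrightarrow> pdivides_rat p k r"
proof -
  have "p > 0" using p by (simp add: prime_gt_0_nat)
  then have "(of_nat p ^ j * r * of_int b = of_int (int p ^ (k + j) * a)) \<longleftrightarrow>
        (r * of_int b = of_int (int p ^ k * a))" for a b
    by (simp add: power_add field_simps)
  then show ?thesis unfolding pdivides_rat_def by simp
qed

lemma pdivides_rat_bounded: "\<exists>j. pdivides_rat p 0 (of_nat p ^ j * r)"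
proof -
  obtain n d where q: "quotient_of r = (n, d)" by fastforce
  have r: "r = of_int n / of_int d" and d: "d > 0"
    using q by (auto simp: quotient_of_div quotient_of_denom_pos)
  have "\<not> is_unit (int p)" using p by (simp add: prime_nat_iff)
  then obtain e where e: "d = int p ^ multiplicity (int p) d * e" "\<not> int p dvd e"
    using multiplicity_decompose'[of d "int p"] d by auto
  have "of_int d * (of_nat p ^ multiplicity (int p) d * r * of_int e) =
      of_int d * of_int n * (of_int (int p ^ multiplicity (int p) d * e) / of_int d)"
    by (simp add: r)
  then have "of_nat p ^ multiplicity (int p) d * r * of_int e = of_int n"
    using d e(1) by simp
  then show ?thesis using e(2) unfolding pdivides_rat_def by auto
qed

text \<open>Write r = n/d in lowest terms. If p divides d, then n is prime to p and serves as
  denominator of \<open>of_nat p ^ k / r\<close>. Otherwise n = p^m e with e prime to p, and m < k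
  because p^k does not divide r; then e serves as denominator.\<close>

lemma pdivides_rat_inverse:
  assumes "\<not> pdivides_rat p k r"
  shows "pdivides_rat p 0 (of_nat p ^ k / r)"
proof -
  obtain n d where q: "quotient_of r = (n, d)" by fastforce
  have r: "r = of_int n / of_int d" and d: "d > 0" and cop: "coprime n d"
    using q by (auto simp: quotient_of_div quotient_of_denom_pos quotient_of_coprime)
  have n: "n \<noteq> 0" using assms r by auto
  have nu: "\<not> is_unit (int p)" using p by (simp add: prime_nat_iff)
  show ?thesis
  proof (cases "int p dvd d")
    case True
    then have "\<not> int p dvd n" using cop nu by (metis coprime_common_divisor)
    moreover have "of_nat p ^ k / r * of_int n = of_int (int p ^ 0 * (int p ^ k * d))"
      using n d by (simp add: r)
    ultimately show ?thesis unfolding pdivides_rat_def by blast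
  next
    case False
    obtain e where e: "n = int p ^ multiplicity (int p) n * e" "\<not> int p dvd e"
      using multiplicity_decompose'[of n "int p"] n nu by auto
    define m where "m = multiplicity (int p) n"
    have "m < k"
    proof (rule ccontr)
      assume "\<not> m < k"
      then have "int p ^ k dvd n" unfolding m_def by (intro multiplicity_dvd') simp
      then obtain a where "n = int p ^ k * a" by blast
      then have "r * of_int d = of_int (int p ^ k * a)" using d by (simp add: r)
      then show False using False assms unfolding pdivides_rat_def by blast
    qed
    then have "int p ^ k * e = int p ^ (k - m) * n"
      unfolding m_def by (subst (2) e(1)) (simp flip: mult.assoc power_add)
    then have "(of_nat p ^ k * of_int e :: rat) = of_nat p ^ (k - m) * of_int n"
      by (metis of_int_mult of_int_of_nat_eq of_int_power)
    then have "of_nat p ^ k / r * of_int e = of_int (int p ^ 0 * (int p ^ (k - m) * d))"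
      using n d by (simp add: r field_simps)
    then show ?thesis using e(2) unfolding pdivides_rat_def by blast
  qed
qed

section \<open>Cauchy sequences, null sequences and their quotient\<close>

lemma padic_cauchy_iff:
  "s \<in> padic_cauchy p \<longleftrightarrow> (\<forall>k. \<exists>M. \<forall>m\<ge>M. \<forall>n\<ge>M. pdivides_rat p k (s m - s n))"
  unfolding padic_cauchy_def by (simp add: padic_val_ge_iff[OF p])

lemma padic_null_iff:
  "s \<in> padic_null p \<longleftrightarrow> (\<forall>k. \<exists>M. \<forall>n\<ge>M. pdivides_rat p k (s n))"
  unfolding padic_null_def by (simp add: padic_val_ge_iff[OF p])

lemma padic_cauchyD:
  assumes "s \<in> padic_cauchy p"
  obtains M where "\<And>m n. m \<ge> M \<Longrightarrow> n \<ge> M \<Longrightarrow> pdivides_rat p k (s m - s n)"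
  using assms unfolding padic_cauchy_iff by blast

lemma padic_nullD:
  assumes "s \<in> padic_null p"
  obtains M where "\<And>n. n \<ge> M \<Longrightarrow> pdivides_rat p k (s n)"
  using assms unfolding padic_null_iff by blast

lemma padic_null_subset_cauchy: "padic_null p \<subseteq> padic_cauchy p"
  unfolding subset_iff padic_null_iff padic_cauchy_iff by (meson pdivides_rat_diff)

text \<open>Beyond some M all terms differ from \<open>s M\<close> by p-integral rationals, and each
  of the finitely many remaining terms has its own denominator exponent. Bounded denominators are
  what makes products of Cauchy sequences Cauchy.\<close>

lemma padic_cauchy_bounded:
  assumes "s \<in> padic_cauchy p"
  shows "\<exists>j. \<forall>n. pdivides_rat p 0 (of_nat p ^ j * s n)"
proof -
  obtain M where M: "\<And>m n. m \<ge> M \<Longrightarrow> n \<ge> M \<Longrightarrow> pdivides_rat p 0 (s m - s n)"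
    using padic_cauchyD[OF assms] by blast
  obtain j where j: "\<And>n. pdivides_rat p 0 (of_nat p ^ j n * s n)"
    using choice[of "\<lambda>n j. pdivides_rat p 0 (of_nat p ^ j * s n)"] pdivides_rat_bounded by blast
  have scale: "pdivides_rat p 0 (of_nat p ^ b * r)" if "pdivides_rat p 0 (of_nat p ^ a * r)" "a \<le> b" for a b r
  proof -
    have "(of_nat p :: rat) ^ b * r = of_int (int p ^ (b - a)) * (of_nat p ^ a * r)"
      using that(2) by (simp flip: mult.assoc power_add)
    also have "pdivides_rat p 0 \<dots>"
      by (rule pdivides_rat_mult0[OF _ that(1)]) (simp only: pdivides_rat_of_int[OF p] power_0 one_dvd)
    finally show ?thesis .
  qed
  \<comment> \<open>The sum serves as a common upper bound of the exponents \<open>j n\<close> with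
    \<open>n \<le> M\<close>.\<close>
  define J where "J = (\<Sum>n\<le>M. j n)"
  have J: "pdivides_rat p 0 (of_nat p ^ J * s n)" if "n \<le> M" for n
    by (rule scale[OF j]) (use that in \<open>auto simp: J_def intro!: member_le_sum\<close>)
  have "pdivides_rat p 0 (of_nat p ^ J * s n)" for n
  proof (cases "n \<le> M")
    case False
    have "pdivides_rat p 0 (of_nat p ^ J * (s n - s M))"
      using scale[of 0 "s n - s M" J] M[of n M] False by simp
    then have "pdivides_rat p 0 (of_nat p ^ J * s M + of_nat p ^ J * (s n - s M))"
      using J[of M] pdivides_rat_add by blast
    then show ?thesis by (simp add: algebra_simps)
  qed (use J in auto)
  then show ?thesis by blast
qed

lemma pdivides_rat_mult_bounded:
  assumes "pdivides_rat p 0 (of_nat p ^ j * r)" "pdivides_rat p (k + j) s"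
  shows "pdivides_rat p k (r * s)"
  using pdivides_rat_mult0[OF assms] pdivides_rat_cancel[of k j "r * s"] by (simp add: mult.assoc)

lemma padic_cauchy_add:
  assumes "s \<in> padic_cauchy p" "t \<in> padic_cauchy p"
  shows "(\<lambda>n. s n + t n) \<in> padic_cauchy p"
  unfolding padic_cauchy_iff
proof
  fix k
  obtain M where M: "\<And>m n. m \<ge> M \<Longrightarrow> n \<ge> M \<Longrightarrow> pdivides_rat p k (s m - s n)"
    using padic_cauchyD[OF assms(1)] by blast
  obtain M' where M': "\<And>m n. m \<ge> M' \<Longrightarrow> n \<ge> M' \<Longrightarrow> pdivides_rat p k (t m - t n)"
    using padic_cauchyD[OF assms(2)] by blast
  have "pdivides_rat p k ((s m + t m) - (s n + t n))" if "m \<ge> max M M'" "n \<ge> max M M'" for m n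
    using pdivides_rat_add[OF M[of m n] M'[of m n]] that by (simp add: algebra_simps)
  then show "\<exists>M. \<forall>m\<ge>M. \<forall>n\<ge>M. pdivides_rat p k ((s m + t m) - (s n + t n))" by blast
qed

lemma padic_cauchy_mult:
  assumes "s \<in> padic_cauchy p" "t \<in> padic_cauchy p"
  shows "(\<lambda>n. s n * t n) \<in> padic_cauchy p"
  unfolding padic_cauchy_iff
proof
  fix k
  obtain i where i: "\<And>n. pdivides_rat p 0 (of_nat p ^ i * s n)"
    using padic_cauchy_bounded[OF assms(1)] by blast
  obtain j where j: "\<And>n. pdivides_rat p 0 (of_nat p ^ j * t n)"
    using padic_cauchy_bounded[OF assms(2)] by blast
  obtain M where M: "\<And>m n. m \<ge> M \<Longrightarrow> n \<ge> M \<Longrightarrow> pdivides_rat p (k + j) (s m - s n)"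
    using padic_cauchyD[OF assms(1)] by blast
  obtain M' where M': "\<And>m n. m \<ge> M' \<Longrightarrow> n \<ge> M' \<Longrightarrow> pdivides_rat p (k + i) (t m - t n)"
    using padic_cauchyD[OF assms(2)] by blast
  have "pdivides_rat p k (s m * t m - s n * t n)" if "m \<ge> max M M'" "n \<ge> max M M'" for m n
  proof -
    have "pdivides_rat p k (s m * (t m - t n) + t n * (s m - s n))"
      using that by (intro pdivides_rat_add pdivides_rat_mult_bounded[OF i] pdivides_rat_mult_bounded[OF j] M M') auto
    then show ?thesis by (simp add: algebra_simps)
  qed
  then show "\<exists>M. \<forall>m\<ge>M. \<forall>n\<ge>M. pdivides_rat p k (s m * t m - s n * t n)" by blast
qed

lemma padic_cauchy_const: "(\<lambda>_. r) \<in> padic_cauchy p"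
  unfolding padic_cauchy_iff by simp

lemma padic_null_add:
  assumes "s \<in> padic_null p" "t \<in> padic_null p"
  shows "(\<lambda>n. s n + t n) \<in> padic_null p"
  unfolding padic_null_iff
proof
  fix k
  obtain M where M: "\<And>n. n \<ge> M \<Longrightarrow> pdivides_rat p k (s n)"
    using padic_nullD[OF assms(1)] by blast
  obtain M' where M': "\<And>n. n \<ge> M' \<Longrightarrow> pdivides_rat p k (t n)"
    using padic_nullD[OF assms(2)] by blast
  show "\<exists>M. \<forall>n\<ge>M. pdivides_rat p k (s n + t n)"
    by (rule exI[of _ "max M M'"]) (auto intro!: pdivides_rat_add M M')
qed

lemma padic_null_mult:
  assumes "s \<in> padic_cauchy p" "t \<in> padic_null p"
  shows "(\<lambda>n. s n * t n) \<in> padic_null p"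
  unfolding padic_null_iff
proof
  fix k
  obtain i where i: "\<And>n. pdivides_rat p 0 (of_nat p ^ i * s n)"
    using padic_cauchy_bounded[OF assms(1)] by blast
  obtain M where M: "\<And>n. n \<ge> M \<Longrightarrow> pdivides_rat p (k + i) (t n)"
    using padic_nullD[OF assms(2)] by blast
  show "\<exists>M. \<forall>n\<ge>M. pdivides_rat p k (s n * t n)"
    by (rule exI[of _ M]) (auto intro!: pdivides_rat_mult_bounded[OF i] M)
qed

lemma padic_cauchy_uminus: "s \<in> padic_cauchy p \<Longrightarrow> (\<lambda>n. - s n) \<in> padic_cauchy p"
  using padic_cauchy_mult[OF padic_cauchy_const[of "-1"], of s] by simp

lemma padic_cauchy_ring_simps [simp]:
  "carrier (padic_cauchy_ring p) = padic_cauchy p"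
  "monoid.mult (padic_cauchy_ring p) = (\<lambda>s t n. s n * t n)"
  "monoid.one (padic_cauchy_ring p) = (\<lambda>n. 1)"
  "ring.zero (padic_cauchy_ring p) = (\<lambda>n. 0)"
  "ring.add (padic_cauchy_ring p) = (\<lambda>s t n. s n + t n)"
  by (simp_all add: padic_cauchy_ring_def)

lemma cring_padic_cauchy_ring: "cring (padic_cauchy_ring p)"
proof (rule cringI)
  show "abelian_group (padic_cauchy_ring p)"
  proof (rule abelian_groupI)
    fix s assume "s \<in> carrier (padic_cauchy_ring p)"
    then show "\<exists>t\<in>carrier (padic_cauchy_ring p). t \<oplus>\<^bsub>padic_cauchy_ring p\<^esub> s = \<zero>\<^bsub>padic_cauchy_ring p\<^esub>"
      using padic_cauchy_uminus[of s] by (intro bexI[of _ "\<lambda>n. - s n"]) auto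
  qed (auto intro: padic_cauchy_add padic_cauchy_const simp: algebra_simps)
  show "Group.comm_monoid (padic_cauchy_ring p)"
    by (rule comm_monoidI) (auto intro: padic_cauchy_mult padic_cauchy_const simp: algebra_simps)
qed (auto simp: algebra_simps)

lemma ideal_padic_null: "ideal (padic_null p) (padic_cauchy_ring p)"
proof -
  interpret R: cring "padic_cauchy_ring p" by (rule cring_padic_cauchy_ring)
  show ?thesis
  proof (rule idealI)
    show "ring (padic_cauchy_ring p)" by (rule R.ring_axioms)
    show "subgroup (padic_null p) (add_monoid (padic_cauchy_ring p))"
    proof (rule group.subgroupI)
      show "Group.group (add_monoid (padic_cauchy_ring p))" by (rule R.a_group)
      show "padic_null p \<subseteq> carrier (add_monoid (padic_cauchy_ring p))"
        using padic_null_subset_cauchy by simp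
      show "padic_null p \<noteq> {}" using padic_null_iff[of "\<lambda>_. 0"] by auto
    next
      fix s assume s: "s \<in> padic_null p"
      then have sc: "s \<in> padic_cauchy p" using padic_null_subset_cauchy by auto
      have "inv\<^bsub>add_monoid (padic_cauchy_ring p)\<^esub> s = (\<lambda>n. - s n)"
        by (rule group.inv_equality[OF R.a_group])
           (use sc padic_cauchy_uminus[OF sc] in auto)
      then show "inv\<^bsub>add_monoid (padic_cauchy_ring p)\<^esub> s \<in> padic_null p"
        using padic_null_mult[OF padic_cauchy_const[of "-1"] s] by simp
    next
      fix s t assume "s \<in> padic_null p" "t \<in> padic_null p"
      then show "s \<otimes>\<^bsub>add_monoid (padic_cauchy_ring p)\<^esub> t \<in> padic_null p"
        using padic_null_add by simp
    qed
  next
    fix s t assume st: "s \<in> padic_null p" "t \<in> carrier (padic_cauchy_ring p)"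
    then show "t \<otimes>\<^bsub>padic_cauchy_ring p\<^esub> s \<in> padic_null p"
      using padic_null_mult[of t s] by simp
    then show "s \<otimes>\<^bsub>padic_cauchy_ring p\<^esub> t \<in> padic_null p"
      by (simp add: mult.commute)
  qed
qed

text \<open>If some p^k fails to divide infinitely many terms, the Cauchy property makes it fail for
  all large n. Then p^k / s n is integral for these n: s has an inverse up to a power of p that
  stays within the integral sequences.\<close>

lemma padic_integral_inverse:
  assumes s: "s \<in> padic_cauchy p" and notnull: "s \<notin> padic_null p"
  obtains k t where "t \<in> padic_cauchy p" "\<And>n. pdivides_rat p 0 (t n)"
    "(\<lambda>n. s n * t n - of_nat p ^ k) \<in> padic_null p"
proof -
  obtain k where k: "\<And>M. \<exists>n\<ge>M. \<not> pdivides_rat p k (s n)"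
    using notnull unfolding padic_null_iff by blast
  obtain M where M: "\<And>m n. m \<ge> M \<Longrightarrow> n \<ge> M \<Longrightarrow> pdivides_rat p k (s m - s n)"
    using padic_cauchyD[OF s] by blast
  have nd: "\<not> pdivides_rat p k (s n)" if "n \<ge> M" for n
  proof
    assume d: "pdivides_rat p k (s n)"
    obtain m where m: "m \<ge> M" "\<not> pdivides_rat p k (s m)" using k by blast
    show False using pdivides_rat_add[OF d M[OF m(1) that]] m(2) by simp
  qed
  then have nz: "s n \<noteq> 0" if "n \<ge> M" for n using that by (metis pdivides_rat_0)
  \<comment> \<open>Terms before M may vanish or be too divisible by p; the value 0 there keeps t
    integral and does not affect limits.\<close>
  define t where "t = (\<lambda>n. if n \<ge> M then of_nat p ^ k / s n else 0)"
  have t: "pdivides_rat p 0 (t n)" for n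
    using pdivides_rat_inverse[OF nd] by (simp add: t_def)
  have "t \<in> padic_cauchy p"
    unfolding padic_cauchy_iff
  proof
    fix j
    obtain M' where M': "\<And>m n. m \<ge> M' \<Longrightarrow> n \<ge> M' \<Longrightarrow> pdivides_rat p (j + k) (s m - s n)"
      using padic_cauchyD[OF s] by blast
    have "pdivides_rat p j (t m - t n)" if mn: "m \<ge> max M M'" "n \<ge> max M M'" for m n
    proof -
      \<comment> \<open>The factor p^k gained when the difference of the reciprocals is written over
        a common denominator costs k digits, hence the precision \<open>j + k\<close> asked of
        s.\<close>
      have "pdivides_rat p (j + k) (t m * (t n * (s n - s m)))"
        using mn by (intro pdivides_rat_mult0 t M') auto
      also have "t m * (t n * (s n - s m)) = of_nat p ^ k * (t m - t n)"
        using mn nz[of m] nz[of n] by (simp add: t_def field_simps)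
      finally show ?thesis by (simp add: pdivides_rat_cancel)
    qed
    then show "\<exists>M. \<forall>m\<ge>M. \<forall>n\<ge>M. pdivides_rat p j (t m - t n)" by blast
  qed
  moreover have "(\<lambda>n. s n * t n - of_nat p ^ k) \<in> padic_null p"
    unfolding padic_null_iff by (intro allI exI[of _ M]) (auto simp: t_def nz)
  ultimately show thesis using that t by blast
qed

section \<open>The embedding evaluated on representing sequences\<close>

context
  fixes \<iota> :: "(nat \<Rightarrow> rat) set \<Rightarrow> 'l::field_char_0"
  assumes emb: "padic_embedding p \<iota>"
begin

text \<open>The embedding composed with the quotient map, so that identities in the image of the
  p-adic field can be checked termwise on sequences.\<close>

definition seq_image :: "(nat \<Rightarrow> rat) \<Rightarrow> 'l" where
  "seq_image s = \<iota> (padic_null p +>\<^bsub>padic_cauchy_ring p\<^esub> s)"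

lemma seq_image_hom: "seq_image \<in> Ring.ring_hom (padic_cauchy_ring p) (ring_of_type_algebra :: 'l ring)"
proof -
  interpret ideal "padic_null p" "padic_cauchy_ring p" by (rule ideal_padic_null)
  have "\<iota> \<circ> (+>\<^bsub>padic_cauchy_ring p\<^esub>) (padic_null p) \<in>
      Ring.ring_hom (padic_cauchy_ring p) (ring_of_type_algebra :: 'l ring)"
    by (rule ring_hom_trans[OF rcos_ring_hom])
       (use emb in \<open>simp add: padic_embedding_def padic_field_def\<close>)
  then show ?thesis by (simp add: seq_image_def[abs_def] comp_def)
qed

lemma seq_image_add:
  "s \<in> padic_cauchy p \<Longrightarrow> t \<in> padic_cauchy p \<Longrightarrow> seq_image (\<lambda>n. s n + t n) = seq_image s + seq_image t"
  using ring_hom_add[OF seq_image_hom, of s t] by (simp add: ring_of_type_algebra_def)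

lemma seq_image_mult:
  "s \<in> padic_cauchy p \<Longrightarrow> t \<in> padic_cauchy p \<Longrightarrow> seq_image (\<lambda>n. s n * t n) = seq_image s * seq_image t"
  using ring_hom_mult[OF seq_image_hom, of s t] by (simp add: ring_of_type_algebra_def)

lemma seq_image_1: "seq_image (\<lambda>n. 1) = 1"
  using ring_hom_one[OF seq_image_hom] by (simp add: ring_of_type_algebra_def)

lemma seq_image_null:
  assumes "s \<in> padic_null p"
  shows "seq_image s = 0"
proof -
  interpret ideal "padic_null p" "padic_cauchy_ring p" by (rule ideal_padic_null)
  have z: "(\<lambda>n. 0) \<in> padic_null p" using padic_null_iff by auto
  have "seq_image s = seq_image (\<lambda>n. 0)"
    unfolding seq_image_def using a_coset_join2[OF _ a_subgroup] assms z padic_null_subset_cauchy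
    by (metis (no_types, lifting) a_rcos_zero padic_cauchy_ring_simps(1) subsetD is_ideal)
  moreover have "seq_image (\<lambda>n. 0) + seq_image (\<lambda>n. 0) = seq_image (\<lambda>n. 0)"
    using seq_image_add[of "\<lambda>n. 0" "\<lambda>n. 0"] padic_cauchy_const by simp
  ultimately show ?thesis by simp
qed

lemma seq_image_of_nat: "seq_image (\<lambda>_. of_nat n) = of_nat n"
proof (induction n)
  case 0
  show ?case using seq_image_null[of "\<lambda>_. 0"] padic_null_iff by auto
next
  case (Suc n)
  then show ?case using seq_image_add[OF padic_cauchy_const padic_cauchy_const, of 1 "of_nat n"]
    by (simp add: seq_image_1)
qed

lemma seq_image_uminus:
  assumes "s \<in> padic_cauchy p"
  shows "seq_image (\<lambda>n. - s n) = - seq_image s"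
  using seq_image_add[OF assms padic_cauchy_uminus[OF assms]] seq_image_of_nat[of 0]
  by (simp add: eq_neg_iff_add_eq_0 add.commute)

lemma seq_image_of_int: "seq_image (\<lambda>_. of_int n) = of_int n"
proof (cases "n \<ge> 0")
  case True
  then show ?thesis using seq_image_of_nat[of "nat n"] by simp
next
  case False
  then show ?thesis
    using seq_image_of_nat[of "nat (-n)"] seq_image_uminus[OF padic_cauchy_const, of "of_int (-n)"] by simp
qed

text \<open>A coset containing an integral sequence is the coset of that sequence, so integral
  sequences parametrize the image of the p-adic integers.\<close>

lemma image_padic_integers:
  "\<iota> ` padic_integers p = {seq_image s |s. s \<in> padic_cauchy p \<and> (\<forall>n. pdivides_rat p 0 (s n))}"
proof -
  interpret ideal "padic_null p" "padic_cauchy_ring p" by (rule ideal_padic_null)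
  have val0: "(padic_val p r \<ge> 0) = pdivides_rat p 0 r" for r
    using padic_val_ge_iff[OF p, of 0 r] by (simp add: zero_ereal_def)
  have car: "carrier (padic_field p) = a_rcosets\<^bsub>padic_cauchy_ring p\<^esub> (padic_null p)"
    by (simp add: padic_field_def FactRing_def)
  show ?thesis
  proof (intro equalityI subsetI)
    fix y assume "y \<in> \<iota> ` padic_integers p"
    then obtain z s where z: "y = \<iota> z" "z \<in> a_rcosets\<^bsub>padic_cauchy_ring p\<^esub> (padic_null p)"
      "s \<in> z" "\<And>n. pdivides_rat p 0 (s n)"
      unfolding padic_integers_def car val0 by auto
    obtain s0 where s0: "s0 \<in> padic_cauchy p" "z = padic_null p +>\<^bsub>padic_cauchy_ring p\<^esub> s0"
      using z(2) unfolding A_RCOSETS_def' by auto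
    have sc: "s \<in> padic_cauchy p"
      using z(2,3) a_rcosets_carrier by fastforce
    have "z = padic_null p +>\<^bsub>padic_cauchy_ring p\<^esub> s"
      using a_repr_independence[OF _ _ a_subgroup, of s s0] z(3) s0 by simp
    then show "y \<in> {seq_image s |s. s \<in> padic_cauchy p \<and> (\<forall>n. pdivides_rat p 0 (s n))}"
      using sc z by (auto simp: seq_image_def)
  next
    fix y assume "y \<in> {seq_image s |s. s \<in> padic_cauchy p \<and> (\<forall>n. pdivides_rat p 0 (s n))}"
    then obtain s where s: "y = seq_image s" "s \<in> padic_cauchy p" "\<And>n. pdivides_rat p 0 (s n)" by auto
    have "s \<in> padic_null p +>\<^bsub>padic_cauchy_ring p\<^esub> s"
      using a_rcos_self[of s] s(2) by simp
    moreover have "padic_null p +>\<^bsub>padic_cauchy_ring p\<^esub> s \<in> carrier (padic_field p)"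
      unfolding car using s(2) by (auto simp: A_RCOSETS_def')
    ultimately show "y \<in> \<iota> ` padic_integers p"
      using s by (auto simp: padic_integers_def val0 seq_image_def)
  qed
qed

lemma image_padic_integersE:
  assumes "b \<in> \<iota> ` padic_integers p"
  obtains s where "b = seq_image s" "s \<in> padic_cauchy p" "\<And>n. pdivides_rat p 0 (s n)"
  using assms unfolding image_padic_integers by auto

lemma seq_image_in_integers:
  "s \<in> padic_cauchy p \<Longrightarrow> (\<And>n. pdivides_rat p 0 (s n)) \<Longrightarrow> seq_image s \<in> \<iota> ` padic_integers p"
  unfolding image_padic_integers by auto

lemma unital_subring_padic_integers: "unital_subring (\<iota> ` padic_integers p)"
  unfolding unital_subring_def
proof (intro conjI ballI)
  show "1 \<in> \<iota> ` padic_integers p"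
    using seq_image_in_integers[of "\<lambda>n. 1"] seq_image_1 padic_cauchy_const pdivides_rat_of_int[OF p, of 0 1]
    by simp
next
  fix x y assume "x \<in> \<iota> ` padic_integers p" "y \<in> \<iota> ` padic_integers p"
  then obtain s t where s: "x = seq_image s" "s \<in> padic_cauchy p" "\<And>n. pdivides_rat p 0 (s n)"
    and t: "y = seq_image t" "t \<in> padic_cauchy p" "\<And>n. pdivides_rat p 0 (t n)"
    by (metis image_padic_integersE)
  have "x - y = seq_image (\<lambda>n. s n + - t n)"
    using seq_image_add[OF s(2) padic_cauchy_uminus[OF t(2)]] seq_image_uminus[OF t(2)]
    by (simp only: s t diff_conv_add_uminus)
  then show "x - y \<in> \<iota> ` padic_integers p"
    using seq_image_in_integers[OF padic_cauchy_add[OF s(2) padic_cauchy_uminus[OF t(2)]]]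
      pdivides_rat_add pdivides_rat_uminus s(3) t(3) by metis
  have "x * y = seq_image (\<lambda>n. s n * t n)"
    using seq_image_mult[OF s(2) t(2)] s t by simp
  then show "x * y \<in> \<iota> ` padic_integers p"
    using seq_image_in_integers[OF padic_cauchy_mult[OF s(2) t(2)]] pdivides_rat_mult0 s(3) t(3) by metis
qed

lemma inverse_of_int_padic_integer:
  assumes "\<not> int p dvd c"
  shows "inverse (of_int c) \<in> \<iota> ` padic_integers p"
proof -
  have c0: "c \<noteq> 0" using assms by auto
  have "pdivides_rat p 0 (1 / of_int c)" unfolding pdivides_rat_def
    using assms c0 by (intro exI[of _ 1] exI[of _ c]) simp
  then have "seq_image (\<lambda>_. 1 / of_int c) \<in> \<iota> ` padic_integers p"
    using seq_image_in_integers padic_cauchy_const by blast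
  moreover have "of_int c * seq_image (\<lambda>_. 1 / of_int c) = 1"
    using seq_image_mult[OF padic_cauchy_const padic_cauchy_const, of "of_int c" "1 / of_int c"] c0
    by (simp add: seq_image_of_int seq_image_1)
  then have "seq_image (\<lambda>_. 1 / of_int c) = inverse (of_int c)"
    by (metis inverse_unique)
  ultimately show ?thesis by simp
qed

text \<open>The inverse up to a power of p from \<open>padic_integral_inverse\<close>, transported
  by the embedding. As p^k is nonzero in characteristic 0, it also shows that only null sequences
  are mapped to 0.\<close>

lemma seq_image_mult_eq_power:
  assumes "s \<in> padic_cauchy p" "s \<notin> padic_null p"
  shows "\<exists>k. \<exists>b'\<in>\<iota> ` padic_integers p. seq_image s * b' = of_nat p ^ k"
proof -
  obtain k t where t: "t \<in> padic_cauchy p" "\<And>n. pdivides_rat p 0 (t n)"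
    "(\<lambda>n. s n * t n - of_nat p ^ k) \<in> padic_null p"
    using padic_integral_inverse[OF assms] by blast
  have "seq_image (\<lambda>n. s n * t n) =
      seq_image (\<lambda>n. (s n * t n - of_nat p ^ k) + of_nat (p ^ k))"
    by simp
  also have "\<dots> = seq_image (\<lambda>n. s n * t n - of_nat p ^ k) + seq_image (\<lambda>n. of_nat (p ^ k))"
    by (rule seq_image_add) (use t padic_null_subset_cauchy padic_cauchy_const in auto)
  also have "\<dots> = of_nat p ^ k"
    unfolding seq_image_null[OF t(3)] seq_image_of_nat by simp
  finally show ?thesis
    using seq_image_mult[OF assms(1) t(1)] seq_image_in_integers[OF t(1,2)] by metis
qed

lemma padic_integer_dvd_power:
  assumes "b \<in> \<iota> ` padic_integers p" "b \<noteq> 0"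
  shows "\<exists>k. \<exists>b'\<in>\<iota> ` padic_integers p. b * b' = of_nat p ^ k"
proof -
  obtain s where "b = seq_image s" "s \<in> padic_cauchy p" using image_padic_integersE[OF assms(1)] by blast
  then show ?thesis using seq_image_mult_eq_power seq_image_null assms(2) by metis
qed

text \<open>If an integral sequence s represented 1/p, the sequence p s - 1 would have image 0 and
  hence be null; since p divides every p s n, it would then divide 1.\<close>

lemma inverse_prime_not_padic_integer: "inverse (of_nat p) \<notin> \<iota> ` padic_integers p"
proof
  assume "inverse (of_nat p) \<in> \<iota> ` padic_integers p"
  then obtain s where s: "inverse (of_nat p) = seq_image s" "s \<in> padic_cauchy p" "\<And>n. pdivides_rat p 0 (s n)"
    using image_padic_integersE by blast
  have p0: "(of_nat p :: 'l) \<noteq> 0" using p by auto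
  define u where "u = (\<lambda>n. of_nat p * s n + of_int (-1))"
  have u: "u \<in> padic_cauchy p" unfolding u_def
    by (intro padic_cauchy_add padic_cauchy_mult padic_cauchy_const s)
  have "seq_image u = of_nat p * seq_image s - 1"
    unfolding u_def
    using seq_image_add[OF padic_cauchy_mult[OF padic_cauchy_const s(2)] padic_cauchy_const, of "of_nat p" "of_int (-1)"]
      seq_image_mult[OF padic_cauchy_const s(2), of "of_nat p"] seq_image_of_nat seq_image_of_int[of "-1"]
    by simp
  then have 0: "seq_image u = 0" using p0 by (simp flip: s(1))
  have "u \<notin> padic_null p"
  proof
    assume "u \<in> padic_null p"
    then obtain M where "\<And>n. n \<ge> M \<Longrightarrow> pdivides_rat p 1 (u n)" using padic_nullD by blast
    then have "pdivides_rat p 1 (u M)" by simp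
    moreover have "pdivides_rat p 1 (of_nat p * s M)"
      using pdivides_rat_cancel[of 0 1 "s M"] s(3) by simp
    ultimately have "pdivides_rat p 1 (of_nat p * s M - u M)" by (rule pdivides_rat_diff[rotated])
    then have "pdivides_rat p 1 (of_int 1)" by (simp add: u_def)
    then show False using pdivides_rat_of_int[OF p, of 1 1] p by (simp add: prime_nat_iff)
  qed
  then show False using seq_image_mult_eq_power[OF u] 0 p0 by auto
qed

end
end

section \<open>The residue order\<close>

lemma ring_of_type_algebra_simps [simp]:
  "carrier (ring_of_type_algebra :: 'l::comm_ring_1 ring) = UNIV"
  "monoid.mult (ring_of_type_algebra :: 'l ring) = (*)"
  "monoid.one (ring_of_type_algebra :: 'l ring) = 1"
  "ring.zero (ring_of_type_algebra :: 'l ring) = 0"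
  "ring.add (ring_of_type_algebra :: 'l ring) = (+)"
  by (simp_all add: ring_of_type_algebra_def)

lemma padic_adjoin_subfield:
  fixes \<iota> :: "(nat \<Rightarrow> rat) set \<Rightarrow> 'l::field" and S :: "'l set"
  shows "unital_subring (padic_adjoin p \<iota> S)" "S \<subseteq> padic_adjoin p \<iota> S"
    "\<And>z. z \<in> padic_adjoin p \<iota> S \<Longrightarrow> inverse z \<in> padic_adjoin p \<iota> S"
proof -
  interpret T: Ring.field "ring_of_type_algebra :: 'l ring" by (rule field_from_type_algebra)
  have neg: "\<ominus>\<^bsub>ring_of_type_algebra\<^esub> y = - y" for y :: 'l
    by (rule T.minus_equality) auto
  have inv: "inv\<^bsub>ring_of_type_algebra\<^esub> y = inverse y" if "y \<noteq> 0" for y :: 'l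
    by (rule T.comm_inv_char) (use that in auto)
  define K where "K = padic_adjoin p \<iota> S"
  have K: "K = generate_field (ring_of_type_algebra :: 'l ring) (\<iota> ` carrier (padic_field p) \<union> S)"
    by (simp add: K_def padic_adjoin_def)
  have add: "x + y \<in> K" if "x \<in> K" "y \<in> K" for x y
    using generate_field.eng_add[OF that[unfolded K]] by (simp add: K)
  have minus: "- x \<in> K" if "x \<in> K" for x
    using generate_field.a_inv[OF that[unfolded K]] by (simp add: K neg)
  have "unital_subring K" unfolding unital_subring_def
  proof (intro conjI ballI)
    show "1 \<in> K" using generate_field.one[of "ring_of_type_algebra :: 'l ring"] by (simp add: K)
    fix x y assume xy: "x \<in> K" "y \<in> K"
    show "x - y \<in> K" using add[OF xy(1) minus[OF xy(2)]] by simp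
    show "x * y \<in> K" using generate_field.eng_mult[OF xy[unfolded K]] by (simp add: K)
  qed
  then show "unital_subring (padic_adjoin p \<iota> S)" by (simp add: K_def)
  show "S \<subseteq> padic_adjoin p \<iota> S"
    unfolding padic_adjoin_def by (auto intro: generate_field.incl)
  show "inverse z \<in> padic_adjoin p \<iota> S" if "z \<in> padic_adjoin p \<iota> S" for z
  proof (cases "z = 0")
    case False
    then show ?thesis using generate_field.m_inv[OF that[unfolded padic_adjoin_def]]
      by (simp add: padic_adjoin_def inv)
  qed (use that in auto)
qed

lemma cring_restrict_unital_subring:
  fixes O' :: "'l::comm_ring_1 set"
  assumes "unital_subring O'"
  shows "cring (ring_of_type_algebra\<lparr>carrier := O'\<rparr>)"
proof -
  interpret T: cring "ring_of_type_algebra :: 'l ring" by (rule cring_from_type_algebra)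
  have neg: "\<ominus>\<^bsub>ring_of_type_algebra\<^esub> y = - y" for y :: 'l
    by (rule T.minus_equality) auto
  have "subring O' (ring_of_type_algebra :: 'l ring)"
    by (rule T.subringI) (use unital_subringD[OF assms] in \<open>auto simp: neg\<close>)
  then show ?thesis using T.subcring_iff[of O'] T.subcringI' by simp
qed

text \<open>Lagrange's theorem in the subgroup generated by the residue classes of S, read back as a
  congruence modulo q. If that subgroup is infinite, \<open>card\<close> is 0 and the assertion is
  about \<open>z [^] 0\<close>.\<close>

lemma (in cring) power_card_generate_units_quotient:
  fixes S :: "'a set"
  assumes q: "q \<in> carrier R" and S: "S \<subseteq> Units R" and z: "z \<in> S"
  defines "I \<equiv> PIdl q"
  defines "N \<equiv> card (generate (units_of (R Quot I)) ((\<lambda>z. I +> z) ` S))"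
  shows "\<exists>u\<in>carrier R. z [^] N = u \<otimes> q \<oplus> \<one>"
proof -
  interpret I: ideal I R unfolding I_def by (rule cgenideal_ideal[OF q])
  interpret Q: ring "R Quot I" by (rule I.quotient_is_ring)
  interpret h: ring_hom_ring R "R Quot I" "(+>) I" by (rule I.rcos_ring_hom_ring)
  interpret U: Group.group "units_of (R Quot I)" by (rule Q.units_group)
  have unit: "I +> y \<in> Units (R Quot I)" if y: "y \<in> S" for y
  proof -
    have yU: "y \<in> Units R" using S y by auto
    have "(I +> y) \<otimes>\<^bsub>R Quot I\<^esub> (I +> inv y) = \<one>\<^bsub>R Quot I\<^esub>"
      "(I +> inv y) \<otimes>\<^bsub>R Quot I\<^esub> (I +> y) = \<one>\<^bsub>R Quot I\<^esub>"
      using yU h.hom_mult[of y "inv y"] h.hom_mult[of "inv y" y] h.hom_one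
      by (simp_all add: Units_closed Units_inv_closed)
    moreover have "I +> y \<in> carrier (R Quot I)" "I +> inv y \<in> carrier (R Quot I)"
      using yU by (auto intro!: h.hom_closed)
    ultimately show ?thesis unfolding Units_def[of "R Quot I"] by blast
  qed
  define H where "H = generate (units_of (R Quot I)) ((\<lambda>z. I +> z) ` S)"
  have sub: "subgroup H (units_of (R Quot I))" unfolding H_def
    by (rule U.generate_is_subgroup) (use unit in \<open>auto simp: units_of_carrier\<close>)
  interpret H: Group.group "units_of (R Quot I)\<lparr>carrier := H\<rparr>"
    by (rule U.subgroup_imp_group[OF sub])
  have zH: "I +> z \<in> H" unfolding H_def using z by (auto intro: generate.incl)
  have "(I +> z) [^]\<^bsub>units_of (R Quot I)\<lparr>carrier := H\<rparr>\<^esub> N = \<one>\<^bsub>R Quot I\<^esub>"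
    using H.pow_order_eq_1[of "I +> z"] zH by (simp add: Coset.order_def N_def H_def units_of_one)
  then have "(I +> z) [^]\<^bsub>R Quot I\<^esub> N = \<one>\<^bsub>R Quot I\<^esub>"
    by (simp add: nat_pow_def units_of_mult units_of_one)
  moreover have zR: "z \<in> carrier R" using S z by (auto simp: Units_def)
  have "(I +> z) [^]\<^bsub>R Quot I\<^esub> n = I +> (z [^] n)" for n :: nat
  proof (induction n)
    case 0
    then show ?case using h.hom_one by simp
  next
    case (Suc n)
    then show ?case using h.hom_mult[of "z [^] n" z] zR by simp
  qed
  ultimately have "I +> (z [^] N) = I +> \<one>" using h.hom_one by simp
  then have "z [^] N \<in> I +> \<one>" using I.a_rcos_self[of "z [^] N"] zR by simp
  then obtain i where "i \<in> I" "z [^] N = i \<oplus> \<one>" by (auto simp: a_r_coset_def')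
  then show ?thesis unfolding I_def cgenideal_def by auto
qed

text \<open>The preceding lemma for the ring of integers of the field generated by S: its carrier is
  the field intersected with the integral closure, the elements of S are units in it, and the
  cofactor u is therefore integral.\<close>

lemma residue_order_power:
  fixes \<iota> :: "(nat \<Rightarrow> rat) set \<Rightarrow> 'l::field_char_0" and S :: "'l set"
  assumes p: "Factorial_Ring.prime p" and emb: "padic_embedding p \<iota>"
    and S: "\<And>z. z \<in> S \<Longrightarrow> z \<noteq> 0 \<and> integral_over (\<iota> ` padic_integers p) z
              \<and> integral_over (\<iota> ` padic_integers p) (inverse z)"
    and z: "z \<in> S"
  shows "\<exists>u. integral_over (\<iota> ` padic_integers p) u \<and>
             z ^ residue_order p \<iota> S k = 1 + of_nat p ^ k * u"
proof -
  define R where "R = ring_of_integers p \<iota> (padic_adjoin p \<iota> S)"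
  define O' where "O' = {z \<in> padic_adjoin p \<iota> S. integral_over (\<iota> ` padic_integers p) z}"
  have R: "R = ring_of_type_algebra\<lparr>carrier := O'\<rparr>"
    by (simp add: R_def ring_of_integers_def O'_def integral_over_def)
  note K = padic_adjoin_subfield[where p = p and \<iota> = \<iota> and S = S]
  have O': "unital_subring O'"
    using K(1) unital_subring_integral_closure[OF unital_subring_padic_integers[OF p emb]]
    unfolding O'_def unital_subring_def by auto
  interpret R: cring R unfolding R by (rule cring_restrict_unital_subring[OF O'])
  have units: "S \<subseteq> Units R"
  proof
    fix y assume y: "y \<in> S"
    then have "y \<in> O'" "inverse y \<in> O'" "y \<noteq> 0" using S[OF y] K(2,3) by (auto simp: O'_def)
    then show "y \<in> Units R" unfolding Units_def by (auto simp: R intro!: bexI[of _ "inverse y"])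
  qed
  have q: "of_nat (p ^ k) \<in> carrier R" using unital_subring_of_nat[OF O', of "p ^ k"] by (simp add: R del: of_nat_power)
  obtain u where u: "u \<in> carrier R"
    "z [^]\<^bsub>R\<^esub> residue_order p \<iota> S k = u \<otimes>\<^bsub>R\<^esub> of_nat (p ^ k) \<oplus>\<^bsub>R\<^esub> \<one>\<^bsub>R\<^esub>"
    using R.power_card_generate_units_quotient[OF q units z]
    unfolding residue_order_def Let_def R_def[symmetric] by auto
  have "z [^]\<^bsub>R\<^esub> n = z ^ n" for n :: nat
    by (induction n) (simp_all add: R mult.commute)
  then have "z ^ residue_order p \<iota> S k = 1 + of_nat p ^ k * u"
    using u(2) by (simp add: R mult.commute add.commute)
  then show ?thesis using u(1) by (auto simp: R O'_def)
qed

section \<open>Congruences in a valuation ring\<close>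

lemma degree_monom_minus_one:
  assumes "n > 0"
  shows "Polynomial.degree (Polynomial.monom 1 n - 1 :: 'a::comm_ring_1 poly) = n"
    and "lead_coeff (Polynomial.monom 1 n - 1 :: 'a poly) = 1"
proof -
  show "Polynomial.degree (Polynomial.monom 1 n - 1 :: 'a poly) = n"
  proof (rule antisym)
    show "Polynomial.degree (Polynomial.monom 1 n - 1 :: 'a poly) \<le> n"
      by (intro degree_diff_le) (auto simp: degree_monom_eq)
    show "n \<le> Polynomial.degree (Polynomial.monom 1 n - 1 :: 'a poly)"
      by (rule le_degree) (use assms in \<open>auto simp: coeff_1\<close>)
  qed
  then show "lead_coeff (Polynomial.monom 1 n - 1 :: 'a poly) = 1"
    using assms by (simp add: coeff_1)
qed

text \<open>The ring need not have rank one: a nonzero element of A may be divisible by all powers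
  of p. Vanishing is concluded only for elements integral over the p-adic integers, in
  \<open>separated\<close>.\<close>

locale padic_valuation_ring =
  fixes A :: "'f::field_char_0 set" and p :: nat
  assumes valuation: "valuation_subring A" and prime_p: "Factorial_Ring.prime p"
    and inverse_p_notin: "inverse (of_nat p) \<notin> A"
begin

lemma subring_A: "unital_subring A"
  using valuation by (simp add: valuation_subring_def)

lemmas A_closed = unital_subringD[OF subring_A] unital_subring_power[OF subring_A]
  unital_subring_of_nat[OF subring_A] unital_subring_of_int[OF subring_A]

text \<open>Divisibility with quotient in A, because \<open>dvd\<close> is trivial on a field
  type.\<close>

definition divisible :: "'f \<Rightarrow> 'f \<Rightarrow> bool" where
  "divisible m x \<longleftrightarrow> (\<exists>g\<in>A. x = m * g)"

lemma of_nat_p_nonzero: "(of_nat p :: 'f) \<noteq> 0"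
  using prime_p by auto

lemma divisibleI: "g \<in> A \<Longrightarrow> x = m * g \<Longrightarrow> divisible m x"
  unfolding divisible_def by blast

lemma divisible_0 [simp]: "divisible m 0"
  by (rule divisibleI[of 0]) (auto simp: A_closed)

lemma divisible_add: "divisible m x \<Longrightarrow> divisible m y \<Longrightarrow> divisible m (x + y)"
  unfolding divisible_def by (metis A_closed(5) distrib_left)

lemma divisible_mult: "divisible m x \<Longrightarrow> y \<in> A \<Longrightarrow> divisible m (y * x)"
  unfolding divisible_def by (metis A_closed(6) mult.left_commute)

lemma divisible_sum: "(\<And>i. i \<in> I \<Longrightarrow> divisible m (f i)) \<Longrightarrow> divisible m (sum f I)"
  by (induction I rule: infinite_finite_induct) (auto intro: divisible_add)

lemma divisible_of_int: "int m dvd y \<Longrightarrow> divisible (of_nat m) (of_int y)"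
  unfolding divisible_def dvd_def using A_closed(9) by auto

lemma divisible_power_mono:
  assumes "divisible (of_nat p ^ k) x" "j \<le> k"
  shows "divisible (of_nat p ^ j) x"
proof -
  obtain g where g: "g \<in> A" "x = of_nat p ^ k * g" using assms(1) unfolding divisible_def by blast
  then have "x = of_nat p ^ j * (of_nat p ^ (k - j) * g)"
    using assms(2) by (simp flip: mult.assoc power_add)
  then show ?thesis using g(1) A_closed by (intro divisibleI[of "of_nat p ^ (k - j) * g"]) auto
qed

text \<open>With a n + b p = 1, either p/n lies in A and so does 1/n = a + b p/n, or n/p lies in A
  and then so would 1/p = a n/p + b.\<close>

lemma inverse_of_int_in:
  assumes "\<not> int p dvd n"
  shows "inverse (of_int n) \<in> A"
proof -
  have n0: "n \<noteq> 0" using assms by auto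
  have "coprime n (int p)"
    using assms prime_p prime_imp_coprime[of "int p" n] by (simp add: coprime_commute)
  then obtain a b where "a * n + b * int p = 1"
    using bezout_int[of n "int p"] by auto
  then have ab: "of_int a * of_int n + of_int b * of_nat p = (1 :: 'f)"
    by (metis of_int_1 of_int_add of_int_mult of_int_of_nat_eq)
  define y where "y = of_nat p * inverse (of_int n :: 'f)"
  have "y \<in> A"
  proof (rule ccontr)
    assume "y \<notin> A"
    then have "inverse y \<in> A" using valuation by (auto simp: valuation_subring_def)
    moreover have "inverse (of_nat p) = of_int a * inverse y + of_int b"
    proof -
      have "inverse (of_nat p :: 'f) = (of_int a * of_int n + of_int b * of_nat p) * inverse (of_nat p)"
        by (simp add: ab)
      then show ?thesis using of_nat_p_nonzero by (simp add: y_def algebra_simps)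
    qed
    ultimately show False using inverse_p_notin A_closed by metis
  qed
  moreover have "inverse (of_int n) = of_int a + of_int b * y"
  proof -
    have "inverse (of_int n :: 'f) = (of_int a * of_int n + of_int b * of_nat p) * inverse (of_int n)"
      by (simp add: ab)
    then show ?thesis using n0 by (simp add: y_def algebra_simps)
  qed
  ultimately show ?thesis by (simp add: A_closed)
qed

lemma not_divisible_unit:
  assumes "divisible (of_nat p) x" "inverse x \<in> A"
  shows "x = 0"
proof (rule ccontr)
  assume x: "x \<noteq> 0"
  obtain g where g: "g \<in> A" "x = of_nat p * g" using assms(1) unfolding divisible_def by blast
  then have "inverse (of_nat p) = g * inverse x" using x by auto
  then show False using inverse_p_notin g assms(2) A_closed by metis
qed

text \<open>The way back from A to the integers: one factor p at a time, because an integer prime to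
  p is a unit of A and p is not.\<close>

lemma divisible_of_intD:
  assumes "divisible (of_nat p ^ k) (of_int y)"
  shows "int p ^ k dvd y"
  using assms
proof (induction k arbitrary: y)
  case (Suc k)
  have "int p dvd y"
  proof (rule ccontr)
    assume nd: "\<not> int p dvd y"
    have "divisible (of_nat p) (of_int y)" using divisible_power_mono[OF Suc.prems, of 1] by simp
    then have "y = 0" using not_divisible_unit inverse_of_int_in[OF nd] by (metis of_int_eq_0_iff)
    then show False using nd by simp
  qed
  then obtain y' where y': "y = int p * y'" by blast
  obtain g where g: "g \<in> A" "of_int y = of_nat p ^ Suc k * g" using Suc.prems unfolding divisible_def by blast
  then have "of_int y' = of_nat p ^ k * g" using y' of_nat_p_nonzero by simp
  then have "int p ^ k dvd y'" using Suc.IH divisibleI[OF g(1)] by blast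
  then show ?case using y' by simp
qed simp

section \<open>Powers of elements congruent to 1\<close>

text \<open>Controls the terms of degree at least 2 in (1 + p^k u)^p. For j < p the binomial
  coefficient contributes a factor p. For j = p one needs \<open>k + 2 \<le> k * p\<close>, which is
  why p = 2 requires k to be at least 2.\<close>

lemma binomial_prime_power_dvd:
  assumes k: "k \<ge> 2 \<or> k \<ge> 1 \<and> p \<noteq> 2" and j: "2 \<le> j" "j \<le> p"
  shows "p ^ (k + 2) dvd (p choose j) * p ^ (k * j)"
proof (cases "j = p")
  case True
  have p2: "p \<ge> 2" using prime_p by (simp add: prime_ge_2_nat)
  have "k + 2 \<le> k * p"
    using k
  proof
    assume "k \<ge> 2"
    then have "k + 2 \<le> k * 2" by simp
    also have "\<dots> \<le> k * p" using p2 by simp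
    finally show ?thesis .
  next
    assume k1: "k \<ge> 1 \<and> p \<noteq> 2"
    then have "k + 2 \<le> k * 3" by simp
    also have "\<dots> \<le> k * p" using p2 k1 by simp
    finally show ?thesis .
  qed
  then have "p ^ (k + 2) dvd p ^ (k * p)" by (rule le_imp_power_dvd)
  then show ?thesis using True by (metis dvd_mult)
next
  case False
  then have "p dvd (p choose j)" using j prime_p by (intro dvd_choose_prime) auto
  moreover have "p ^ (k + 1) dvd p ^ (k * j)"
  proof (rule le_imp_power_dvd)
    have "k + 1 \<le> k * 2" using k by auto
    also have "\<dots> \<le> k * j" using j by simp
    finally show "k + 1 \<le> k * j" .
  qed
  ultimately have "p * p ^ (k + 1) dvd (p choose j) * p ^ (k * j)" by (rule mult_dvd_mono)
  then show ?thesis by simp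
qed

text \<open>In the binomial expansion only the linear term survives modulo p^(k+2), so a p-th power
  raises the exponent k by one and preserves u modulo p.\<close>

lemma one_plus_power_prime:
  assumes k: "k \<ge> 2 \<or> k \<ge> 1 \<and> p \<noteq> 2" and u: "u \<in> A"
  shows "\<exists>u'\<in>A. (1 + of_nat p ^ k * u) ^ p = 1 + of_nat p ^ (k + 1) * (u + of_nat p * u')"
proof -
  have p2: "p \<ge> 2" using prime_p by (simp add: prime_ge_2_nat)
  define t where "t = (\<lambda>j. of_nat (p choose j) * (of_nat p ^ k * u) ^ j)"
  have "divisible (of_nat p ^ (k + 2)) (t j)" if j: "j \<in> {2..p}" for j
  proof -
    have "p ^ (k + 2) dvd (p choose j) * p ^ (k * j)"
      using binomial_prime_power_dvd[OF k] j by simp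
    then obtain d where d: "(p choose j) * p ^ (k * j) = p ^ (k + 2) * d" by blast
    have "t j = of_nat ((p choose j) * p ^ (k * j)) * u ^ j"
      by (simp add: t_def power_mult_distrib power_mult)
    also have "\<dots> = of_nat p ^ (k + 2) * (of_nat d * u ^ j)"
      unfolding d by simp
    finally show ?thesis using u A_closed by (intro divisibleI[of "of_nat d * u ^ j"]) auto
  qed
  then have "divisible (of_nat p ^ (k + 2)) (sum t {2..p})" by (rule divisible_sum)
  then obtain g where g: "g \<in> A" "sum t {2..p} = of_nat p ^ (k + 2) * g" unfolding divisible_def by blast
  have "(1 + of_nat p ^ k * u) ^ p = sum t {..p}"
    using binomial_ring[of "of_nat p ^ k * u" 1 p] by (simp add: t_def add.commute)
  also have "{..p} = insert 0 (insert 1 {2..p})" using p2 by auto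
  also have "sum t \<dots> = 1 + of_nat p * (of_nat p ^ k * u) + sum t {2..p}"
    by (simp add: t_def)
  also have "\<dots> = 1 + of_nat p ^ (k + 1) * (u + of_nat p * g)"
    unfolding g(2) by (simp add: algebra_simps)
  finally show ?thesis using g(1) by blast
qed

lemma one_plus_power_prime_power:
  assumes k: "k \<ge> 2 \<or> k \<ge> 1 \<and> p \<noteq> 2" and u: "u \<in> A"
  shows "\<exists>u'\<in>A. (1 + of_nat p ^ k * u) ^ (p ^ m) = 1 + of_nat p ^ (k + m) * (u + of_nat p * u')"
proof (induction m)
  case 0
  then show ?case using A_closed by (intro bexI[of _ 0]) auto
next
  case (Suc m)
  then obtain u' where u': "u' \<in> A"
    "(1 + of_nat p ^ k * u) ^ (p ^ m) = 1 + of_nat p ^ (k + m) * (u + of_nat p * u')" by blast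
  have "u + of_nat p * u' \<in> A" using u u' A_closed by auto
  then obtain w where w: "w \<in> A" "(1 + of_nat p ^ (k + m) * (u + of_nat p * u')) ^ p =
      1 + of_nat p ^ (k + m + 1) * (u + of_nat p * u' + of_nat p * w)"
    using one_plus_power_prime[of "k + m" "u + of_nat p * u'"] k by auto
  have "(1 + of_nat p ^ k * u) ^ (p ^ Suc m) = ((1 + of_nat p ^ k * u) ^ (p ^ m)) ^ p"
    by (simp add: mult.commute flip: power_mult)
  also have "\<dots> = 1 + of_nat p ^ (k + Suc m) * (u + of_nat p * (u' + w))"
    unfolding u'(2) w(2) by (simp add: algebra_simps)
  finally show ?case using u'(1) w(1) A_closed by blast
qed

lemma one_plus_power_linear:
  assumes "w \<in> A"
  shows "\<exists>g\<in>A. (1 + w) ^ s = 1 + of_nat s * w + w * w * g"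
proof (induction s)
  case 0
  then show ?case using A_closed by (intro bexI[of _ 0]) auto
next
  case (Suc s)
  then obtain g where g: "g \<in> A" "(1 + w) ^ s = 1 + of_nat s * w + w * w * g" by blast
  have "(1 + w) ^ Suc s = 1 + of_nat (Suc s) * w + w * w * (of_nat s + g + w * g)"
    unfolding power_Suc g(2) by (simp add: algebra_simps)
  then show ?case using g(1) assms A_closed by (intro bexI[of _ "of_nat s + g + w * g"]) auto
qed

text \<open>Write s = p^m s'. The p^m-th power is handled by iterating the step for p, the s'-th
  power by the linear expansion, whose quadratic remainder is small enough.\<close>

lemma one_plus_power_expansion:
  assumes k: "k \<ge> 2 \<or> k \<ge> 1 \<and> p \<noteq> 2" and u: "u \<in> A" and s: "p ^ m dvd s"
  shows "\<exists>g\<in>A. (1 + of_nat p ^ k * u) ^ s = 1 + of_nat s * of_nat p ^ k * u + of_nat p ^ (k + m + 1) * g"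
proof -
  obtain s' where s': "s = p ^ m * s'" using s by blast
  obtain u' where u': "u' \<in> A"
    "(1 + of_nat p ^ k * u) ^ (p ^ m) = 1 + of_nat p ^ (k + m) * (u + of_nat p * u')"
    using one_plus_power_prime_power[OF k u] by blast
  define h where "h = u + of_nat p * u'"
  have h: "h \<in> A" using u u' A_closed by (auto simp: h_def)
  obtain g where g: "g \<in> A" "(1 + of_nat p ^ (k + m) * h) ^ s' =
      1 + of_nat s' * (of_nat p ^ (k + m) * h) + of_nat p ^ (k + m) * h * (of_nat p ^ (k + m) * h) * g"
    using one_plus_power_linear[of "of_nat p ^ (k + m) * h" s'] h A_closed by auto
  \<comment> \<open>As k + m is positive, 2 (k + m) = (k + m + 1) + e, which puts the quadratic
    remainder into the error term.\<close>
  obtain e where e: "k + m = Suc e" using k by (cases "k + m") auto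
  have "(1 + of_nat p ^ k * u) ^ s = ((1 + of_nat p ^ k * u) ^ (p ^ m)) ^ s'"
    by (simp add: s' power_mult)
  also have "\<dots> = 1 + of_nat s' * (of_nat p ^ (k + m) * h) + of_nat p ^ (k + m) * h * (of_nat p ^ (k + m) * h) * g"
    unfolding u'(2) h_def[symmetric] g(2) by (rule refl)
  also have "of_nat p ^ (k + m) * h * (of_nat p ^ (k + m) * h) * g =
      of_nat p ^ (k + m + 1) * (of_nat p ^ e * h * h * g)"
    by (simp add: e)
  also have "of_nat s' * (of_nat p ^ (k + m) * h) =
      of_nat s * of_nat p ^ k * u + of_nat p ^ (k + m + 1) * (of_nat s' * u')"
    by (simp add: s' h_def power_add algebra_simps)
  finally have "(1 + of_nat p ^ k * u) ^ s = 1 + of_nat s * of_nat p ^ k * u +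
      of_nat p ^ (k + m + 1) * (of_nat s' * u' + of_nat p ^ e * h * h * g)"
    by (simp add: algebra_simps)
  then show ?thesis using u'(1) h g(1) A_closed
    by (intro bexI[of _ "of_nat s' * u' + of_nat p ^ e * h * h * g"]) auto
qed

section \<open>Terms along an arithmetic progression of difference N\<close>

text \<open>In each summand L^(N s) - 1 agrees with s p^k u modulo p^(k+m+1). The factor L^(N t) is
  1 modulo p and multiplies a quantity already divisible by p^(k+m), so the slope is independent of
  t to this precision.\<close>

lemma progression_affine:
  fixes C L u :: "'i \<Rightarrow> 'f" and x :: "nat \<Rightarrow> int"
  assumes k: "k \<ge> 2 \<or> k \<ge> 1 \<and> p \<noteq> 2"
    and A: "\<And>i. i \<in> I \<Longrightarrow> C i \<in> A \<and> L i \<in> A \<and> u i \<in> A"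
    and L: "\<And>i. i \<in> I \<Longrightarrow> L i ^ N = 1 + of_nat p ^ k * u i"
    and x: "\<And>n. of_int (x n) = (\<Sum>i\<in>I. C i * L i ^ n)"
    and s: "p ^ m dvd s"
  shows "int p ^ (k + m + 1) dvd x (l + N * (t + s)) - x (l + N * t) - int s * (x (l + N) - x l)"
proof (rule divisible_of_intD)
  \<comment> \<open>The contribution of index i to the deviation from affine behaviour, with
    \<open>L i ^ N - 1\<close> replaced by \<open>of_nat p ^ k * u i\<close>.\<close>
  define d where "d = (\<lambda>i. C i * L i ^ l * ((L i ^ N) ^ t * ((L i ^ N) ^ s - 1) - of_nat s * (of_nat p ^ k * u i)))"
  have "of_int (x (l + N * (t + s)) - x (l + N * t) - int s * (x (l + N) - x l)) = (\<Sum>i\<in>I. d i)"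
  proof -
    have "C i * L i ^ (l + N * (t + s)) - C i * L i ^ (l + N * t)
        - of_nat s * (C i * L i ^ (l + N) - C i * L i ^ l) = d i" if "i \<in> I" for i
    proof -
      have "C i * L i ^ (l + N * (t + s)) - C i * L i ^ (l + N * t)
        - of_nat s * (C i * L i ^ (l + N) - C i * L i ^ l)
        = C i * L i ^ l * ((L i ^ N) ^ t * ((L i ^ N) ^ s - 1) - of_nat s * (L i ^ N - 1))"
        by (simp add: power_add power_mult algebra_simps)
      then show ?thesis unfolding d_def using L[OF that] by simp
    qed
    then have "(\<Sum>i\<in>I. d i) = (\<Sum>i\<in>I. C i * L i ^ (l + N * (t + s)) - C i * L i ^ (l + N * t)
        - of_nat s * (C i * L i ^ (l + N) - C i * L i ^ l))"
      by (intro sum.cong) auto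
    also have "\<dots> = of_int (x (l + N * (t + s)) - x (l + N * t) - int s * (x (l + N) - x l))"
      by (simp only: sum_subtractf sum_distrib_left[symmetric] x of_int_diff of_int_mult of_int_of_nat_eq)
    finally show ?thesis by simp
  qed
  moreover have "divisible (of_nat p ^ (k + m + 1)) (d i)" if i: "i \<in> I" for i
  proof -
    have ui: "u i \<in> A" using A[OF i] by simp
    obtain g where g: "g \<in> A" "(L i ^ N) ^ s = 1 + of_nat s * of_nat p ^ k * u i + of_nat p ^ (k + m + 1) * g"
      using one_plus_power_expansion[OF k ui s] L[OF i] by auto
    obtain h where h: "h \<in> A" "(L i ^ N) ^ t = 1 + of_nat t * of_nat p ^ k * u i + of_nat p ^ (k + 0 + 1) * h"
      using one_plus_power_expansion[OF k ui, of 0 t] L[OF i] by auto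
    obtain s' where s': "s = p ^ m * s'" using s by blast
    obtain e where e: "k = Suc e" using k by (cases k) auto
    \<comment> \<open>Since k is at least 1, one factor p can be extracted from the expansion of
      \<open>(L i ^ N) ^ t - 1\<close>.\<close>
    define h' where "h' = of_nat t * of_nat p ^ e * u i + of_nat p ^ k * h"
    have h': "h' \<in> A" "(L i ^ N) ^ t = 1 + of_nat p * h'"
      using h ui A_closed by (auto simp: h'_def e algebra_simps)
    have "(L i ^ N) ^ t * ((L i ^ N) ^ s - 1) - of_nat s * (of_nat p ^ k * u i) =
        of_nat p ^ (k + m + 1) * (h' * of_nat s' * u i + (L i ^ N) ^ t * g)"
    proof -
      have "(L i ^ N) ^ t * ((L i ^ N) ^ s - 1) - of_nat s * (of_nat p ^ k * u i) =
         ((L i ^ N) ^ t - 1) * (of_nat s * of_nat p ^ k * u i) + (L i ^ N) ^ t * (of_nat p ^ (k + m + 1) * g)"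
        unfolding g(2) by (simp add: algebra_simps)
      also have "\<dots> = of_nat p * h' * (of_nat s * of_nat p ^ k * u i) + (L i ^ N) ^ t * (of_nat p ^ (k + m + 1) * g)"
        unfolding h'(2) by simp
      finally show ?thesis by (simp add: s' power_add algebra_simps)
    qed
    moreover have "h' * of_nat s' * u i + (L i ^ N) ^ t * g \<in> A"
      using h' ui g A[OF i] A_closed by auto
    ultimately have "divisible (of_nat p ^ (k + m + 1))
        ((L i ^ N) ^ t * ((L i ^ N) ^ s - 1) - of_nat s * (of_nat p ^ k * u i))"
      by (rule divisibleI[rotated])
    then show ?thesis unfolding d_def using A[OF i] A_closed by (intro divisible_mult) auto
  qed
  ultimately show "divisible (of_nat p ^ (k + m + 1))
      (of_int (x (l + N * (t + s)) - x (l + N * t) - int s * (x (l + N) - x l)))"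
    using divisible_sum[of I _ d] by simp
qed

lemma progression_step_dvd:
  fixes C L u :: "'i \<Rightarrow> 'f" and x :: "nat \<Rightarrow> int"
  assumes A: "\<And>i. i \<in> I \<Longrightarrow> C i \<in> A \<and> L i \<in> A \<and> u i \<in> A"
    and L: "\<And>i. i \<in> I \<Longrightarrow> L i ^ N = 1 + of_nat p ^ k * u i"
    and x: "\<And>n. of_int (x n) = (\<Sum>i\<in>I. C i * L i ^ n)"
  shows "int p ^ k dvd x (l + N) - x l"
proof (rule divisible_of_intD)
  have "of_int (x (l + N) - x l) = (\<Sum>i\<in>I. C i * L i ^ (l + N) - C i * L i ^ l)"
    by (simp add: x sum_subtractf)
  also have "\<dots> = (\<Sum>i\<in>I. C i * L i ^ l * (of_nat p ^ k * u i))"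
  proof (rule sum.cong)
    fix i assume "i \<in> I"
    then show "C i * L i ^ (l + N) - C i * L i ^ l = C i * L i ^ l * (of_nat p ^ k * u i)"
      unfolding power_add L[OF \<open>i \<in> I\<close>] by (simp add: algebra_simps)
  qed simp
  also have "divisible (of_nat p ^ k) \<dots>"
    using A by (intro divisible_sum divisible_mult divisibleI[OF _ refl] A_closed) auto
  finally show "divisible (of_nat p ^ k) (of_int (x (l + N) - x l))" .
qed

text \<open>A factor outside A has its inverse in A; multiplying by that inverse would put the
  shorter product into A.\<close>

lemma prod_mset_notin:
  assumes "\<And>y. y \<in># M \<Longrightarrow> f y \<notin> A" "M \<noteq> {#}"
  shows "(\<Prod>y\<in>#M. f y) \<notin> A"
  using assms
proof (induction M)
  case (add y M)
  show ?case
  proof (cases "M = {#}")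
    case False
    have y: "f y \<notin> A" and M: "(\<Prod>y\<in>#M. f y) \<notin> A" using add False by auto
    have inv: "inverse (f y) \<in> A" and nz: "f y \<noteq> 0"
      using y valuation A_closed(1) by (auto simp: valuation_subring_def)
    show ?thesis
    proof
      assume "(\<Prod>y\<in>#add_mset y M. f y) \<in> A"
      then have "inverse (f y) * (f y * (\<Prod>y\<in>#M. f y)) \<in> A" using inv A_closed by simp
      then show False using M nz by (simp flip: mult.assoc)
    qed
  qed (use add in auto)
qed simp

end

section \<open>Vanishing of integral elements divisible by all powers of p\<close>

text \<open>In a monic equation of least degree the constant term b is nonzero, since otherwise y
  could be cancelled. From b = - y g(y) every power of p divides b, whereas b divides some p^k in A;
  comparing with p^(k+1) would put 1/p into A.\<close>

lemma (in padic_valuation_ring) separated: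
  assumes B: "B \<subseteq> A" "\<And>b. b \<in> B \<Longrightarrow> b \<noteq> 0 \<Longrightarrow> \<exists>k. \<exists>b'\<in>A. b * b' = of_nat p ^ k"
    and y: "integral_over B y" "\<And>k. divisible (of_nat p ^ k) y"
  shows "y = 0"
proof (rule ccontr)
  assume y0: "y \<noteq> 0"
  define P where "P = (\<lambda>f. lead_coeff f = 1 \<and> (\<forall>i. poly.coeff f i \<in> B) \<and> poly f y = 0)"
  define f where "f = arg_min Polynomial.degree P"
  have ex: "\<exists>f. P f" using y(1) unfolding integral_over_def P_def .
  then have f: "P f" unfolding f_def by (metis arg_min_natI)
  have min: "Polynomial.degree f \<le> Polynomial.degree g" if "P g" for g
    unfolding f_def using that by (rule arg_min_nat_le)
  obtain b g where bg: "f = pCons b g" by (cases f)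
  have g0: "g \<noteq> 0"
  proof
    assume "g = 0"
    then show False using f bg by (auto simp: P_def)
  qed
  have coeffs: "b \<in> B" "\<And>i. poly.coeff g i \<in> B" 
  proof -
    show "b \<in> B" using f bg unfolding P_def by (metis coeff_pCons_0)
    show "poly.coeff g i \<in> B" for i using f bg unfolding P_def by (metis coeff_pCons_Suc)
  qed
  have "b \<noteq> 0"
  proof
    assume "b = 0"
    then have "P g" using f bg g0 y0 coeffs by (auto simp: P_def)
    then show False using min[of g] bg g0 by simp
  qed
  then obtain k b' where b': "b' \<in> A" "b * b' = of_nat p ^ k" using B(2) coeffs(1) by blast
  have "y \<in> A" using y(2)[of 0] by (auto simp: divisible_def)
  then have gA: "poly g y \<in> A" using coeffs(2) B(1) by (intro unital_subring_poly[OF subring_A]) auto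
  have "b = - poly g y * y"
    using f bg by (simp add: P_def eq_neg_iff_add_eq_0 mult.commute)
  then have "divisible (of_nat p ^ Suc k) b"
    using divisible_mult[OF y(2), of "- poly g y" "Suc k"] gA A_closed by (simp del: power_Suc)
  then obtain h where h: "h \<in> A" "b = of_nat p ^ Suc k * h" unfolding divisible_def by blast
  have "of_nat p ^ k * (of_nat p * h * b') = of_nat p ^ k * 1"
    using b'(2) unfolding h(2) by (simp add: algebra_simps)
  then have "of_nat p * (h * b') = 1" using of_nat_p_nonzero by (simp add: mult.assoc)
  then have "inverse (of_nat p) = h * b'" by (rule inverse_unique)
  then show False using inverse_p_notin h(1) b'(1) A_closed by metis
qed

section \<open>Approximation by roots of unity\<close>

locale padic_valuation_ring_closed = padic_valuation_ring A p
  for A :: "'f::{field_char_0,alg_closed_field} set" and p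
begin

text \<open>Factor z^N - 1 into the N differences z - \<zeta>. If none of the quotients (z -
  \<zeta>)/p^M were in A, neither would be their product (z^N - 1)/p^(N M).\<close>

lemma close_to_root_of_unity:
  assumes N: "N > 0" and z: "divisible (of_nat p ^ (N * M)) (z ^ N - 1)"
  shows "\<exists>\<zeta>. \<zeta> ^ N = 1 \<and> divisible (of_nat p ^ M) (z - \<zeta>)"
proof -
  define f :: "'f poly" where "f = Polynomial.monom 1 N - 1"
  have deg: "Polynomial.degree f = N" and lc: "lead_coeff f = 1"
    unfolding f_def by (rule degree_monom_minus_one[OF N])+
  have pf: "poly f y = y ^ N - 1" for y by (simp add: f_def poly_monom)
  have "f \<noteq> 0" using deg N by auto
  then obtain R where R: "size R = N" "f = (\<Prod>x\<in>#R. [:-x, 1:])"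
    using alg_closed_imp_factorization[of f] deg lc by auto
  have eval: "y ^ N - 1 = (\<Prod>x\<in>#R. y - x)" for y
    unfolding pf[symmetric] R(2) by (induction R) (auto simp: algebra_simps)
  have "\<exists>x\<in>#R. (z - x) / of_nat p ^ M \<in> A"
  proof (rule ccontr)
    assume "\<not> ?thesis"
    then have "(\<Prod>x\<in>#R. (z - x) / of_nat p ^ M) \<notin> A"
      using R(1) N by (intro prod_mset_notin) auto
    moreover have "(\<Prod>x\<in>#R. (z - x) / of_nat p ^ M) = (z ^ N - 1) / of_nat p ^ (N * M)"
    proof -
      have "(\<Prod>x\<in>#R. (z - x) / of_nat p ^ M) = (\<Prod>x\<in>#R. z - x) / of_nat p ^ (size R * M)"
        using of_nat_p_nonzero by (induction R) (auto simp: power_add field_simps)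
      then show ?thesis using R(1) eval by simp
    qed
    ultimately show False using z of_nat_p_nonzero by (auto simp: divisible_def)
  qed
  then obtain x where x: "x \<in># R" "(z - x) / of_nat p ^ M \<in> A" by blast
  have "x ^ N - 1 = 0" unfolding eval using x(1) by (auto simp: prod_mset_zero_iff)
  then show ?thesis using x(2) of_nat_p_nonzero
    by (intro exI[of _ x]) (auto intro!: divisibleI[OF x(2)])
qed

text \<open>Continuity of integer powers of v at exponent 0: natural exponents follow from the
  expansion above, negative ones from v^(-s) - 1 = - v^(-s) (v^s - 1).\<close>

lemma power_int_near_one:
  assumes k: "k \<ge> 2 \<or> k \<ge> 1 \<and> p \<noteq> 2" and u: "u \<in> A" and v: "v = 1 + of_nat p ^ k * u" "inverse v \<in> A"
    and n: "int p ^ m dvd n"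
  shows "divisible (of_nat p ^ m) (v powi n - 1)"
proof -
  have nat: "divisible (of_nat p ^ m) (v ^ s - 1)" if s: "p ^ m dvd s" for s
  proof -
    obtain g where g: "g \<in> A" "v ^ s = 1 + of_nat s * of_nat p ^ k * u + of_nat p ^ (k + m + 1) * g"
      using one_plus_power_expansion[OF k u s] v(1) by auto
    obtain s' where s': "s = p ^ m * s'" using s by blast
    have "v ^ s - 1 = of_nat p ^ m * (of_nat s' * of_nat p ^ k * u + of_nat p ^ (k + 1) * g)"
      unfolding g(2) by (simp add: s' power_add algebra_simps)
    moreover have "of_nat s' * of_nat p ^ k * u + of_nat p ^ (k + 1) * g \<in> A" using u g A_closed by auto
    ultimately show ?thesis by (rule divisibleI[rotated])
  qed
  have vA: "v \<in> A" unfolding v using u A_closed by auto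
  have v0: "v \<noteq> 0"
  proof
    assume "v = 0"
    then have "divisible (of_nat p ^ k) (1 :: 'f)"
      using v(1) u A_closed by (intro divisibleI[of "- u"]) (auto simp: algebra_simps eq_neg_iff_add_eq_0)
    then have "divisible (of_nat p) (1 :: 'f)" using divisible_power_mono[of k 1 1] k by auto
    then show False using not_divisible_unit[of 1] A_closed by auto
  qed
  show ?thesis
  proof (cases "n \<ge> 0")
    case True
    then obtain s where s: "n = int s" by (metis nonneg_int_cases)
    have "p ^ m dvd s" using n s by (metis of_nat_dvd_iff of_nat_power)
    then show ?thesis using nat s by simp
  next
    case False
    then obtain s where s: "n = - int s" by (metis neg_int_cases linorder_not_le)
    have "p ^ m dvd s" using n s by (metis dvd_minus_iff of_nat_dvd_iff of_nat_power)
    then have "divisible (of_nat p ^ m) (- (inverse v ^ s) * (v ^ s - 1))"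
      using nat v(2) A_closed by (intro divisible_mult) auto
    moreover have "- (inverse v ^ s) * (v ^ s - 1) = v powi n - 1"
      using v0 by (simp add: s power_int_minus field_simps)
    ultimately show ?thesis by simp
  qed
qed

text \<open>If n is near \<alpha>, the N-th power of L^(n - \<alpha>) is near 1, so L^(n - \<alpha>)
  is near an N-th root of unity. Substituting these roots into the small value \<open>x n\<close>
  gives an approximate twisted zero at \<alpha>; finiteness of the set of root tuples yields one
  tuple valid at every precision.\<close>

lemma twisted_zero_accumulation:
  fixes C L u :: "'i \<Rightarrow> 'f" and x :: "nat \<Rightarrow> int"
  assumes k: "k \<ge> 2 \<or> k \<ge> 1 \<and> p \<noteq> 2" and I: "finite I" and N: "N > 0"
    and A: "\<And>i. i \<in> I \<Longrightarrow> C i \<in> A \<and> L i \<in> A \<and> inverse (L i) \<in> A \<and> L i \<noteq> 0 \<and> u i \<in> A"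
    and L: "\<And>i. i \<in> I \<Longrightarrow> L i ^ N = 1 + of_nat p ^ k * u i"
    and x: "\<And>n. of_int (x n) = (\<Sum>i\<in>I. C i * L i ^ n)"
    and acc: "\<And>M. \<exists>n. int p ^ M dvd x n \<and> int p ^ M dvd int n - \<alpha>"
  shows "\<exists>\<xi>. (\<forall>i\<in>I. \<xi> i ^ N = 1) \<and> (\<forall>M. divisible (of_nat p ^ M) (\<Sum>i\<in>I. \<xi> i * C i * L i powi \<alpha>))"
proof -
  \<comment> \<open>Extensional functions, so that the possible tuples of roots of unity form a
    finite set.\<close>
  define F where "F = PiE I (\<lambda>_. {\<zeta>::'f. \<zeta> ^ N = 1})"
  define y where "y = (\<lambda>\<xi>. \<Sum>i\<in>I. \<xi> i * C i * L i powi \<alpha>)"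
  have "finite {\<zeta>::'f. \<zeta> ^ N = 1}"
  proof -
    have "{\<zeta>::'f. \<zeta> ^ N = 1} = {\<zeta>. poly (Polynomial.monom 1 N - 1) \<zeta> = 0}" by (simp add: poly_monom)
    moreover have "Polynomial.monom 1 N - 1 \<noteq> (0 :: 'f poly)"
    proof
      assume "Polynomial.monom 1 N - 1 = (0 :: 'f poly)"
      then have "poly (Polynomial.monom 1 N - 1) (0 :: 'f) = 0" by simp
      then show False using N by (simp add: poly_monom zero_power)
    qed
    ultimately show ?thesis using poly_roots_finite by metis
  qed
  then have fin: "finite F" using I by (auto simp: F_def intro: finite_PiE)
  have each: "\<exists>\<xi>\<in>F. divisible (of_nat p ^ M) (y \<xi>)" for M
  proof -
    \<comment> \<open>Precision N M is requested because approximating by an N-th root of unity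
      retains only M digits.\<close>
    obtain n where n: "int p ^ (N * M) dvd x n" "int p ^ (N * M) dvd int n - \<alpha>" using acc by blast
    have "\<exists>\<zeta>. \<zeta> ^ N = 1 \<and> divisible (of_nat p ^ M) (L i powi (int n - \<alpha>) - \<zeta>)" if i: "i \<in> I" for i
    proof (rule close_to_root_of_unity[OF N])
      have "inverse (L i ^ N) \<in> A" using A[OF i] A_closed(7)[of "inverse (L i)" N] by (simp add: power_inverse)
      then have "divisible (of_nat p ^ (N * M)) ((L i ^ N) powi (int n - \<alpha>) - 1)"
        using A[OF i] by (intro power_int_near_one[OF k _ L[OF i] _ n(2)]) auto
      then show "divisible (of_nat p ^ (N * M)) ((L i powi (int n - \<alpha>)) ^ N - 1)"
        by (simp add: power_int_power power_int_power' mult.commute)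
    qed
    then obtain \<zeta> where \<zeta>: "\<And>i. i \<in> I \<Longrightarrow> \<zeta> i ^ N = 1"
      "\<And>i. i \<in> I \<Longrightarrow> divisible (of_nat p ^ M) (L i powi (int n - \<alpha>) - \<zeta> i)"
      by metis
    define \<xi> where "\<xi> = restrict \<zeta> I"
    \<comment> \<open>Since L^\<alpha> L^(n - \<alpha>) = L^n, replacing L^(n - \<alpha>) by the
      root changes \<open>x n\<close> only by multiples of the small differences.\<close>
    have "y \<xi> = (\<Sum>i\<in>I. - (C i * L i powi \<alpha>) * (L i powi (int n - \<alpha>) - \<zeta> i)) + of_int (x n)"
    proof -
      have "\<xi> i * C i * L i powi \<alpha> = - (C i * L i powi \<alpha>) * (L i powi (int n - \<alpha>) - \<zeta> i) + C i * L i ^ n"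
        if i: "i \<in> I" for i
      proof -
        have "L i powi \<alpha> * L i powi (int n - \<alpha>) = L i ^ n"
          using A[OF i] by (simp flip: power_int_add power_int_of_nat)
        then show ?thesis using i by (simp add: \<xi>_def algebra_simps)
      qed
      then show ?thesis unfolding y_def x by (simp add: sum_subtractf sum_negf)
    qed
    moreover have "divisible (of_nat p ^ M) (of_int (x n))"
      by (rule divisible_power_mono[of "N * M"])
         (use n(1) divisible_of_int[of "p ^ (N * M)" "x n"] N in auto)
    moreover have "divisible (of_nat p ^ M) (\<Sum>i\<in>I. - (C i * L i powi \<alpha>) * (L i powi (int n - \<alpha>) - \<zeta> i))"
      using A by (intro divisible_sum divisible_mult \<zeta>(2) A_closed unital_subring_powi[OF subring_A]) auto
    ultimately have "divisible (of_nat p ^ M) (y \<xi>)" using divisible_add by simp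
    moreover have "\<xi> \<in> F" using \<zeta>(1) by (auto simp: F_def \<xi>_def)
    ultimately show ?thesis by blast
  qed
  \<comment> \<open>If every tuple failed at some exponent of its own, none would work at the sum of
    these exponents, contrary to \<open>each\<close>.\<close>
  have "\<exists>\<xi>\<in>F. \<forall>M. divisible (of_nat p ^ M) (y \<xi>)"
  proof (rule ccontr)
    assume "\<not> ?thesis"
    then obtain M where M: "\<And>\<xi>. \<xi> \<in> F \<Longrightarrow> \<not> divisible (of_nat p ^ M \<xi>) (y \<xi>)" by metis
    obtain \<xi> where \<xi>: "\<xi> \<in> F" "divisible (of_nat p ^ (\<Sum>\<xi>\<in>F. M \<xi>)) (y \<xi>)" using each by blast
    have "M \<xi> \<le> (\<Sum>\<xi>\<in>F. M \<xi>)" using \<xi>(1) fin by (intro member_le_sum) auto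
    then show False using M[OF \<xi>(1)] divisible_power_mono[OF \<xi>(2)] by blast
  qed
  then show ?thesis unfolding y_def F_def by auto
qed

end

section \<open>Newton's method and the conjecture\<close>

text \<open>A Newton step: from p^m dividing f(t), move to t + p^m j with j S congruent to -
  f(t)/p^m modulo p; the linearization error is divisible by p^(m+1). The bound on t makes the
  approximate zeros arbitrarily large.\<close>

lemma newton_zeros:
  fixes f :: "nat \<Rightarrow> int" and S :: int
  assumes p: "Factorial_Ring.prime p" and S: "\<not> int p dvd S"
    and lin: "\<And>m s t. p ^ m dvd s \<Longrightarrow> int p ^ (m + 1) dvd f (t + s) - f t - int s * S"
  shows "\<exists>t\<ge>m. int p ^ m dvd f t"
proof (induction m)
  case (Suc m)
  then obtain t where t: "t \<ge> m" "int p ^ m dvd f t" by blast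
  then obtain y where y: "f t = int p ^ m * y" by blast
  have "coprime S (int p)"
    using S p prime_imp_coprime[of "int p" S] by (simp add: coprime_commute)
  then obtain j0 where j0: "[S * j0 = - y] (mod int p)"
    using cong_solve_dvd_int[of S "int p" "- y"] by auto
  have p0: "int p > 0" using p by (simp add: prime_gt_0_nat)
  \<comment> \<open>Adding p keeps the residue class and makes j positive, so that t strictly
    increases.\<close>
  define j where "j = nat (j0 mod int p) + p"
  have j: "[int j = j0] (mod int p)"
    using p0 by (simp add: j_def cong_def mod_simps)
  then have "[S * int j = - y] (mod int p)"
    using j0 cong_trans cong_scalar_left by blast
  then have "int p dvd y + S * int j" by (simp add: cong_iff_dvd_diff algebra_simps)
  then have 1: "int p ^ Suc m dvd f t + int (p ^ m * j) * S"
  proof -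
    assume "int p dvd y + S * int j"
    then have "int p ^ m * int p dvd int p ^ m * (y + S * int j)" by (rule mult_dvd_mono[OF dvd_refl])
    then show ?thesis unfolding y by (simp add: algebra_simps)
  qed
  have 2: "int p ^ Suc m dvd f (t + p ^ m * j) - f t - int (p ^ m * j) * S"
    using lin[of m "p ^ m * j" t] by simp
  have "int p ^ Suc m dvd f (t + p ^ m * j)"
    using dvd_add[OF 1 2] by (simp add: algebra_simps)
  moreover have "t + p ^ m * j \<ge> Suc m"
  proof -
    have "p ^ m * j > 0" using p0 by (simp add: j_def)
    then show ?thesis using t(1) by linarith
  qed
  ultimately show ?case by blast
qed simp

lemma padic_val_of_int_ge:
  assumes "Factorial_Ring.prime p"
  shows "padic_val p (of_int y) \<ge> ereal (real m) \<longleftrightarrow> int p ^ m dvd y"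
  using padic_val_ge_iff[OF assms] pdivides_rat_of_int[OF assms] by simp

text \<open>
  Pigeonholing the increasingly \<open>p\<close>-divisible terms over the classes modulo \<open>Q\<close> excludes
  alternative (C) in one class; there (L) turns divisibility of \<open>x n\<close> into \<open>n \<rightarrow> \<alpha>\<close>.
\<close>

lemma marques_lengyel_accumulation:
  fixes x :: "int \<Rightarrow> rat" and T :: "int set"
  assumes p: "Factorial_Ring.prime p" and ml: "marques_lengyel p x"
    and T: "\<And>m. \<exists>n\<in>T. n \<ge> int m \<and> (\<exists>y. x n = of_int y \<and> int p ^ m dvd y)"
  shows "\<exists>\<alpha>. \<forall>m. \<exists>n\<in>T. int p ^ m dvd n - \<alpha> \<and> (\<exists>y. x n = of_int y \<and> int p ^ m dvd y)"
proof -
  define D where "D = (\<lambda>m n. n \<in> T \<and> n \<ge> int m \<and> (\<exists>y. x n = of_int y \<and> int p ^ m dvd y))"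
  obtain t where t: "\<And>m. D m (t m)" using T unfolding D_def by metis
  have Dmono: "D j n" if "D m n" "j \<le> m" for j m n
    using that unfolding D_def by (meson le_imp_power_dvd dvd_trans of_nat_mono order_trans)
  obtain Q where Q: "Q > 0" and cases: "\<And>i. i \<in> {0..<Q} \<Longrightarrow>
        (\<exists>\<kappa>::nat. finite {n. [n = i] (mod Q) \<and> padic_val p (x n) \<noteq> ereal (real \<kappa>)}) \<or>
        (\<exists>(\<alpha>::int) (\<kappa>::int) (\<mu>::int). \<mu> > 0 \<and>
           padic_val p (of_int (\<alpha> - i)) \<ge> padic_val p (of_int Q) \<and>
           finite {n. [n = i] (mod Q) \<and>
             padic_val p (x n) \<noteq>
               ereal (real_of_int \<kappa>) + ereal (real_of_int \<mu>) * padic_val p (of_int (n - \<alpha>))})"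
    using ml unfolding marques_lengyel_def by blast
  have "\<exists>i\<in>{0..<Q}. infinite {m. t m mod Q = i}"
  proof -
    have "finite ((\<lambda>m. t m mod Q) ` UNIV)"
      by (rule finite_subset[of _ "{0..<Q}"]) (use Q in auto)
    then obtain m0 where "infinite {m. t m mod Q = t m0 mod Q}"
      using pigeonhole_infinite[of UNIV "\<lambda>m. t m mod Q"] by auto
    then show ?thesis using Q by (intro bexI[of _ "t m0 mod Q"]) auto
  qed
  then obtain i where i: "i \<in> {0..<Q}" "infinite {m. t m mod Q = i}" by blast
  \<comment> \<open>The chosen residue class contains highly divisible terms outside any finite
    exceptional set.\<close>
  have far: "\<exists>n. D M n \<and> [n = i] (mod Q) \<and> n \<notin> E" if E: "finite E" for M E
  proof -
    \<comment> \<open>From index b on, \<open>t m\<close> exceeds every element of E and its term is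
      divisible by at least p^M.\<close>
    define b where "b = nat (Max (insert 0 E)) + M + 1"
    obtain m where m: "m \<ge> b" "t m mod Q = i"
      using i(2) unfolding infinite_nat_iff_unbounded_le by blast
    have "t m > e" if "e \<in> E" for e
    proof -
      have "e \<le> Max (insert 0 E)" using that E by simp
      also have "\<dots> < int m" using m(1) by (auto simp: b_def)
      also have "\<dots> \<le> t m" using t[of m] by (simp add: D_def)
      finally show ?thesis .
    qed
    then have "t m \<notin> E" by blast
    moreover have "D M (t m)" using Dmono[OF t[of m], of M] m(1) by (simp add: b_def)
    moreover have "[t m = i] (mod Q)" using m(2) i(1) by (simp add: cong_def)
    ultimately show ?thesis by blast
  qed
  have val: "padic_val p (x n) \<ge> ereal (real M)" if "D M n" for M n
    using that padic_val_of_int_ge[OF p] by (auto simp: D_def)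
  from cases[OF i(1)] show ?thesis
  proof
    assume "\<exists>\<kappa>::nat. finite {n. [n = i] (mod Q) \<and> padic_val p (x n) \<noteq> ereal (real \<kappa>)}"
    then obtain \<kappa> :: nat where fin: "finite {n. [n = i] (mod Q) \<and> padic_val p (x n) \<noteq> ereal (real \<kappa>)}" by blast
    \<comment> \<open>Under (C) almost all terms of the class have valuation \<kappa>, yet one of
      those is divisible by p^(\<kappa> + 1).\<close>
    obtain n where n: "D (Suc \<kappa>) n" "padic_val p (x n) = ereal (real \<kappa>)" using far[OF fin] by blast
    then show ?thesis using val[OF n(1)] by simp
  next
    assume "\<exists>(\<alpha>::int) (\<kappa>::int) (\<mu>::int). \<mu> > 0 \<and>
           padic_val p (of_int (\<alpha> - i)) \<ge> padic_val p (of_int Q) \<and>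
           finite {n. [n = i] (mod Q) \<and>
             padic_val p (x n) \<noteq>
               ereal (real_of_int \<kappa>) + ereal (real_of_int \<mu>) * padic_val p (of_int (n - \<alpha>))}"
    then obtain \<alpha> \<kappa> \<mu> :: int where \<mu>: "\<mu> > 0" and fin: "finite {n. [n = i] (mod Q) \<and>
             padic_val p (x n) \<noteq>
               ereal (real_of_int \<kappa>) + ereal (real_of_int \<mu>) * padic_val p (of_int (n - \<alpha>))}" by blast
    show ?thesis
    proof (intro exI[of _ \<alpha>] allI)
      fix m
      \<comment> \<open>Since \<mu> > 0, a valuation of n - \<alpha> below m would keep the
        valuation of \<open>x n\<close> below \<kappa> + \<mu> m, hence below M. The summand m
        ensures that p^m also divides the term itself.\<close>
      define M where "M = m + nat (\<kappa> + \<mu> * int m)"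
      obtain n where n: "D M n" "padic_val p (x n) =
          ereal (real_of_int \<kappa>) + ereal (real_of_int \<mu>) * padic_val p (of_int (n - \<alpha>))"
        using far[OF fin] by blast
      have "ereal (real m) \<le> padic_val p (of_int (n - \<alpha>))"
      proof (rule ccontr)
        assume lt: "\<not> ?thesis"
        then obtain v where v: "padic_val p (of_int (n - \<alpha>)) = ereal v" "v < real m"
          by (auto simp: padic_val_def split: if_splits)
        have "real_of_int \<kappa> + real_of_int \<mu> * v < real_of_int \<kappa> + real_of_int \<mu> * real m"
          using v(2) \<mu> by simp
        also have "\<dots> = real_of_int (\<kappa> + \<mu> * int m)" by simp
        also have "\<dots> \<le> real M" unfolding M_def by linarith
        also have "\<dots> \<le> real_of_int \<kappa> + real_of_int \<mu> * v"
          using val[OF n(1)] unfolding n(2) v(1) by simp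
        finally show False by simp
      qed
      then have "int p ^ m dvd n - \<alpha>" using padic_val_of_int_ge[OF p] by blast
      moreover have "D m n" using Dmono[OF n(1)] by (simp add: M_def)
      ultimately show "\<exists>n\<in>T. int p ^ m dvd n - \<alpha> \<and> (\<exists>y. x n = of_int y \<and> int p ^ m dvd y)"
        unfolding D_def by blast
    qed
  qed
qed

section \<open>The coefficients of the Binet formula\<close>

text \<open>
  The Sylvester matrix sends the vector of the powers of \<open>z\<close> to multiples of \<open>f z\<close> and \<open>g z\<close>;
  multiply by the adjugate. The library's indexing of the matrix accounts for the extra factor \<open>z\<close>.
\<close>

lemma resultant_root:
  fixes f g :: "int poly" and z :: "'a::field_char_0"
  assumes root: "poly (of_int_poly f) z = 0" and deg: "Polynomial.degree f + Polynomial.degree g > 0"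
  shows "\<exists>h :: int poly. of_int (resultant f g) * z = poly (of_int_poly h) z * poly (of_int_poly g) z"
proof -
  define m where "m = Polynomial.degree f"
  define n where "n = Polynomial.degree g"
  define d where "d = m + n"
  have d0: "d > 0" using deg by (simp add: d_def m_def n_def)
  define M where "M = sylvester_mat f g"
  have M: "M \<in> carrier_mat d d" unfolding M_def d_def m_def n_def by (rule sylvester_carrier_mat)
  define B where "B = adj_mat M"
  have B: "B \<in> carrier_mat d d" unfolding B_def using adj_mat(1)[OF M] .
  have BM: "B * M = det M \<cdot>\<^sub>m 1\<^sub>m d" unfolding B_def using adj_mat(3)[OF M] .
  have row: "(\<Sum>j<d. of_int (M $$ (i, j)) * z ^ (d - j)) =
      (if i < n then 0 else z ^ (d - i) * poly (of_int_poly g) z)" if i: "i < d" for i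
  proof -
    \<comment> \<open>Row i lists the coefficients of q in degrees d down to 1. The constant
      coefficient, which has no column, vanishes because the monomial factor of q has positive
      degree.\<close>
    define q where "q = (if i < n then Polynomial.monom 1 (n - i) * f else Polynomial.monom 1 (d - i) * g)"
    have Mij: "M $$ (i, j) = poly.coeff q (d - j)" if "j < d" for j
      using sylvester_index_mat2[of i f g j] i that
      unfolding M_def q_def d_def m_def n_def by simp
    have q0: "poly.coeff q 0 = 0"
      using i by (auto simp: q_def coeff_monom_mult)
    have qd: "Polynomial.degree q \<le> d"
    proof (cases "i < n")
      case True
      then show ?thesis using degree_mult_le[of "Polynomial.monom 1 (n - i)" f]
        by (simp add: q_def degree_monom_eq d_def m_def)
    next
      case False
      then show ?thesis using degree_mult_le[of "Polynomial.monom 1 (d - i)" g] i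
        by (simp add: q_def degree_monom_eq d_def n_def)
    qed
    have "(\<Sum>j<d. of_int (M $$ (i, j)) * z ^ (d - j)) = (\<Sum>j<d. of_int (poly.coeff q (d - j)) * z ^ (d - j))"
      by (intro sum.cong) (auto simp: Mij)
    also have "\<dots> = (\<Sum>k\<in>{1..d}. of_int (poly.coeff q k) * z ^ k)"
      by (rule sum.reindex_bij_witness[of _ "\<lambda>k. d - k" "\<lambda>j. d - j"]) auto
    also have "\<dots> = (\<Sum>k\<le>d. of_int (poly.coeff q k) * z ^ k)"
      by (rule sum.mono_neutral_left) (auto simp: q0 not_le)
    also have "\<dots> = poly (of_int_poly q) z"
      unfolding poly_altdef using qd
      by (intro sum.mono_neutral_cong_right) (auto simp: coeff_eq_0)
    also have "\<dots> = (if i < n then 0 else z ^ (d - i) * poly (of_int_poly g) z)"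
      using root by (auto simp: q_def of_int_poly_hom.hom_mult poly_monom)
    finally show ?thesis .
  qed
  \<comment> \<open>The coefficients come from the last row of the adjugate: its product with M is
    the determinant in the last column, the column that carries the power z^1, and 0 elsewhere. Rows
    with i < n contribute nothing at a root of f.\<close>
  define h where "h = (\<Sum>i\<in>{n..<d}. Polynomial.monom (B $$ (d - 1, i)) (d - i))"
  have "of_int (resultant f g) * z = (\<Sum>j<d. of_int ((B * M) $$ (d - 1, j)) * z ^ (d - j))"
  proof -
    have "(\<Sum>j<d. of_int ((B * M) $$ (d - 1, j)) * z ^ (d - j)) =
        (\<Sum>j<d. if j = d - 1 then of_int (det M) * z else 0)"
      by (intro sum.cong) (use d0 in \<open>auto simp: BM\<close>)
    then show ?thesis using d0 by (simp add: resultant_def M_def)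
  qed
  also have "\<dots> = (\<Sum>j<d. (\<Sum>i<d. of_int (B $$ (d - 1, i)) * of_int (M $$ (i, j))) * z ^ (d - j))"
  proof (rule sum.cong)
    fix j assume "j \<in> {..<d}"
    then have "(B * M) $$ (d - 1, j) = (\<Sum>i<d. B $$ (d - 1, i) * M $$ (i, j))"
      using B M d0 by (simp add: scalar_prod_def atLeast0LessThan)
    then show "of_int ((B * M) $$ (d - 1, j)) * z ^ (d - j) =
        (\<Sum>i<d. of_int (B $$ (d - 1, i)) * of_int (M $$ (i, j))) * z ^ (d - j)"
      by simp
  qed simp
  also have "\<dots> = (\<Sum>i<d. of_int (B $$ (d - 1, i)) * (\<Sum>j<d. of_int (M $$ (i, j)) * z ^ (d - j)))"
    unfolding sum_distrib_left sum_distrib_right by (subst sum.swap) (simp add: mult.assoc)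
  also have "\<dots> = (\<Sum>i<d. if i < n then 0 else of_int (B $$ (d - 1, i)) * z ^ (d - i) * poly (of_int_poly g) z)"
    by (intro sum.cong) (auto simp: row)
  also have "\<dots> = (\<Sum>i\<in>{n..<d}. of_int (B $$ (d - 1, i)) * z ^ (d - i) * poly (of_int_poly g) z)"
    by (rule sum.mono_neutral_cong_right) auto
  also have "\<dots> = poly (of_int_poly h) z * poly (of_int_poly g) z"
    by (simp add: h_def of_int_poly_hom.hom_sum poly_sum poly_monom sum_distrib_right)
  finally show ?thesis by blast
qed

section \<open>Transfer to the algebraic closure\<close>

lemma poly_map_to_ac: "poly (map_poly to_ac f) (to_ac z) = to_ac (poly f z)"
  by (induction f) (auto simp: map_poly_pCons)

lemma integral_over_to_ac:
  assumes "integral_over B z"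
  shows "integral_over (to_ac ` B) (to_ac z)"
proof -
  obtain f where f: "lead_coeff f = 1" "\<And>i. poly.coeff f i \<in> B" "poly f z = 0"
    using assms unfolding integral_over_def by blast
  have "Polynomial.degree (map_poly to_ac f) = Polynomial.degree f" by (rule degree_map_poly) simp
  then show ?thesis unfolding integral_over_def using f
    by (intro exI[of _ "map_poly to_ac f"]) (auto simp: poly_map_to_ac coeff_map_poly)
qed

lemma unital_subring_to_ac:
  assumes "unital_subring B"
  shows "unital_subring (to_ac ` B)"
  unfolding unital_subring_def
proof (intro conjI ballI)
  show "1 \<in> to_ac ` B" using unital_subringD(2)[OF assms] by (intro image_eqI[of _ _ 1]) auto
next
  fix x y assume "x \<in> to_ac ` B" "y \<in> to_ac ` B"
  then obtain a b where ab: "x = to_ac a" "y = to_ac b" "a \<in> B" "b \<in> B" by auto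
  show "x - y \<in> to_ac ` B"
    using unital_subringD(3)[OF assms ab(3,4)] ab by (intro image_eqI[of _ _ "a - b"]) auto
  show "x * y \<in> to_ac ` B"
    using unital_subringD(6)[OF assms ab(3,4)] ab by (intro image_eqI[of _ _ "a * b"]) auto
qed

lemma integral_over_root_of_unity:
  assumes "unital_subring B" "z ^ n = 1" "n > 0"
  shows "integral_over B z"
  unfolding integral_over_def
proof (intro exI[of _ "Polynomial.monom 1 n - 1"] conjI allI)
  show "lead_coeff (Polynomial.monom 1 n - 1 :: 'a poly) = 1"
    by (rule degree_monom_minus_one(2)[OF assms(3)])
  show "poly.coeff (Polynomial.monom 1 n - 1) i \<in> B" for i
    using unital_subringD[OF assms(1)] by (auto simp: coeff_1)
  show "poly (Polynomial.monom 1 n - 1) z = 0" using assms(2) by (simp add: poly_monom)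
qed

section \<open>Integrality of the roots, their inverses and the Binet coefficients\<close>

lemma unital_subring_of_int_poly:
  assumes "unital_subring S" "z \<in> S"
  shows "poly (of_int_poly f) z \<in> S"
  by (rule unital_subring_poly[OF assms(1) _ assms(2)]) (simp add: unital_subring_of_int[OF assms(1)])

text \<open>The equation P(z) = 0 reads z (z^2 - a z - b) = c, so z divides the unit c.\<close>

lemma char_poly3_root_unit:
  fixes z :: "'a::field_char_0"
  assumes S: "unital_subring S" "z \<in> S" and root: "poly (of_int_poly (char_poly3 a b c)) z = 0"
    and c: "c \<noteq> 0" "inverse (of_int c) \<in> S"
  shows "z \<noteq> 0" "inverse z \<in> S"
proof -
  have eq: "z * (z * z - of_int a * z - of_int b) = of_int c"
    using root by (simp add: char_poly3_def algebra_simps)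
  then show "z \<noteq> 0" using c(1) by auto
  have "z * ((z * z - of_int a * z - of_int b) * inverse (of_int c)) = 1"
    using eq c(1) by (simp flip: mult.assoc)
  then have "inverse z = (z * z - of_int a * z - of_int b) * inverse (of_int c)"
    by (rule inverse_unique)
  then show "inverse z \<in> S"
    using S(2) c(2) unital_subringD(3,6)[OF S(1)] unital_subring_of_int[OF S(1)] by simp
qed

lemma poly_discriminant_char_poly3:
  "poly_discriminant (char_poly3 a b c) = - resultant (char_poly3 a b c) (pderiv (char_poly3 a b c))"
  by (simp add: poly_discriminant_def char_poly3_def)

text \<open>The denominator P'(z) is a unit: by \<open>resultant_root\<close> it divides the
  resultant of P and P' times z, and both factors are units of S.\<close>

lemma binet_coeff_in_subring:
  fixes z :: "'a::field_char_0"
  assumes S: "unital_subring S" "z \<in> S" "inverse z \<in> S" and z: "z \<noteq> 0"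
    and root: "poly (of_int_poly (char_poly3 a b c)) z = 0"
    and d: "poly_discriminant (char_poly3 a b c) \<noteq> 0"
      "inverse (of_int (poly_discriminant (char_poly3 a b c))) \<in> S"
  shows "binet_coeff a b c x0 x1 x2 z \<in> S"
proof -
  define r where "r = resultant (char_poly3 a b c) (pderiv (char_poly3 a b c))"
  define e where "e = poly (pderiv (of_int_poly (char_poly3 a b c))) z"
  have e: "e = poly (of_int_poly (pderiv (char_poly3 a b c))) z"
    by (simp add: e_def char_poly3_def pderiv_pCons of_int_hom.map_poly_pderiv)
  have r: "r \<noteq> 0" "inverse (of_int r) \<in> S"
    using d unital_subringD(4)[OF S(1) d(2)] by (simp_all add: poly_discriminant_char_poly3 r_def)
  obtain h :: "int poly" where h: "of_int r * z = poly (of_int_poly h) z * e"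
    using resultant_root[OF root, of "pderiv (char_poly3 a b c)"] unfolding e r_def
    by (auto simp: char_poly3_def)
  have "e * (poly (of_int_poly h) z * (inverse (of_int r) * inverse z)) = of_int r * z * (inverse (of_int r) * inverse z)"
    unfolding h by (simp add: mult_ac)
  also have "\<dots> = 1" using r(1) z by (simp add: field_simps)
  finally have "inverse e = poly (of_int_poly h) z * (inverse (of_int r) * inverse z)"
    by (rule inverse_unique)
  then have "inverse e \<in> S"
    using S r(2) unital_subringD(6)[OF S(1)] unital_subring_of_int_poly[OF S(1,2)] by simp
  then show ?thesis unfolding binet_coeff_def e_def[symmetric] divide_inverse
    using unital_subringD(6)[OF S(1)] unital_subring_of_int_poly[OF S(1,2)] by simp
qed

section \<open>Failure of the conjecture\<close>

text \<open>Chevalley's theorem with w = p, applied to the image of the p-adic integers, which omits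
  1/p.\<close>

lemma ex_padic_valuation_ring:
  fixes \<iota> :: "(nat \<Rightarrow> rat) set \<Rightarrow> 'l::field_char_0"
  assumes p: "Factorial_Ring.prime p" and emb: "padic_embedding p \<iota>"
  obtains A :: "'l alg_closure set" where "padic_valuation_ring_closed A p"
    "to_ac ` \<iota> ` padic_integers p \<subseteq> A"
proof -
  let ?B = "to_ac ` \<iota> ` padic_integers p"
  have B: "unital_subring ?B"
    by (rule unital_subring_to_ac[OF unital_subring_padic_integers[OF p emb]])
  have "inverse (of_nat p) \<notin> ?B"
  proof
    assume "inverse (of_nat p) \<in> ?B"
    then obtain b where "b \<in> \<iota> ` padic_integers p" "to_ac (inverse (of_nat p)) = to_ac b" by auto
    then show False using inverse_prime_not_padic_integer[OF p emb] by (metis to_ac_eq_iff)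
  qed
  then obtain A where "valuation_subring A" "?B \<subseteq> A" "inverse (of_nat p) \<notin> A"
    using valuation_subring_exists[OF B unital_subring_of_nat[OF B]] by blast
  then show thesis using that p
    by (simp add: padic_valuation_ring_closed_def padic_valuation_ring_def)
qed

text \<open>Treats both cases uniformly; the condition on k is exactly the one under which the
  expansions of powers of 1 + p^k u hold.\<close>

lemma not_marques_lengyel:
  fixes p :: nat and a b c x0 x1 x2 :: int
    and x :: "int \<Rightarrow> rat"
    and \<iota> :: "(nat \<Rightarrow> rat) set \<Rightarrow> 'l::field_char_0"
    and lam :: "nat \<Rightarrow> 'l"
  assumes p: "Factorial_Ring.prime p"
    and c: "\<not> int p dvd c"
    and rec: "\<And>n. x n = of_int a * x (n - 1) + of_int b * x (n - 2) + of_int c * x (n - 3)"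
    and init: "x 0 = of_int x0" "x 1 = of_int x1" "x 2 = of_int x2"
    and emb: "padic_embedding p \<iota>"
    and split: "of_int_poly (char_poly3 a b c) = (\<Prod>i=1..3. [:- lam i, 1:])"
    and binet: "\<And>n. of_rat (x n) = (\<Sum>i=1..3. binet_coeff a b c x0 x1 x2 (lam i) * lam i powi n)"
    and disc: "\<not> int p dvd poly_discriminant (char_poly3 a b c)"
  defines "Z \<equiv> twisted_zeros (\<lambda>i. binet_coeff a b c x0 x1 x2 (lam i)) lam"
  assumes N_def: "N = int (residue_order p \<iota> (lam ` {1..3}) k)"
    and k: "k \<ge> 2 \<or> k \<ge> 1 \<and> p \<noteq> 2"
    and l: "l \<in> {0..<N}" "int p ^ k dvd \<lfloor>x l\<rfloor>"
      "\<not> [\<lfloor>x (l + N)\<rfloor> - \<lfloor>x l\<rfloor> = 0] (mod int p ^ (k + 1))"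
      "\<forall>r\<in>Z. \<not> [l - (\<lfloor>x l\<rfloor> div int p ^ k)
                * modular_inverse (int p) ((\<lfloor>x (l + N)\<rfloor> - \<lfloor>x l\<rfloor>) div int p ^ k) * N = r] (mod int p)"
  shows "\<not> marques_lengyel p x"
proof
  assume ml: "marques_lengyel p x"
  define B where "B = \<iota> ` padic_integers p"
  \<comment> \<open>The roots, their inverses and the Binet coefficients are first shown to lie in
    this integral closure, and are thereby in any valuation ring containing the p-adic
    integers.\<close>
  define R where "R = {z. integral_over B z}"
  define C where "C = (\<lambda>i. binet_coeff a b c x0 x1 x2 (lam i))"
  have B: "unital_subring B" unfolding B_def by (rule unital_subring_padic_integers[OF p emb])
  have R: "unital_subring R" unfolding R_def by (rule unital_subring_integral_closure[OF B])
  have BR: "B \<subseteq> R" using integral_over_self[OF B] by (auto simp: R_def)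
  have inv: "inverse (of_int d) \<in> R" if "\<not> int p dvd d" for d
    using inverse_of_int_padic_integer[OF p emb that] BR unfolding B_def by blast
  have root: "poly (of_int_poly (char_poly3 a b c)) (lam i) = 0" if "i \<in> {1..3}" for i
    unfolding split poly_prod using that by (intro prod_zero) auto
  have lamR: "lam i \<in> R" if i: "i \<in> {1..3}" for i
  proof -
    have "lead_coeff (of_int_poly (char_poly3 a b c) :: 'l poly) = 1"
      by (simp add: char_poly3_def)
    then show ?thesis unfolding R_def integral_over_def
      using root[OF i] unital_subring_of_int[OF B]
      by (intro CollectI exI[of _ "of_int_poly (char_poly3 a b c)"]) auto
  qed
  have c0: "c \<noteq> 0" and d0: "poly_discriminant (char_poly3 a b c) \<noteq> 0" using c disc by auto
  have unit: "lam i \<noteq> 0" "inverse (lam i) \<in> R" if i: "i \<in> {1..3}" for i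
    using char_poly3_root_unit[OF R lamR[OF i] root[OF i] c0 inv[OF c]] by auto
  have CR: "C i \<in> R" if i: "i \<in> {1..3}" for i
    unfolding C_def by (rule binet_coeff_in_subring[OF R lamR unit(2) unit(1) root d0 inv[OF disc]]) (use i in auto)

  define Nn where "Nn = residue_order p \<iota> (lam ` {1..3}) k"
  have N: "N = int Nn" by (simp add: N_def Nn_def)
  \<comment> \<open>The range of l is nonempty, which excludes the value 0 that \<open>card\<close>
    takes on an infinite group.\<close>
  have Npos: "Nn > 0" using l(1) N by simp
  have "\<exists>u. u \<in> R \<and> lam i ^ Nn = 1 + of_nat p ^ k * u" if i: "i \<in> {1..3}" for i
  proof -
    have "\<exists>v. integral_over (\<iota> ` padic_integers p) v \<and>
        lam i ^ residue_order p \<iota> (lam ` {1..3}) k = 1 + of_nat p ^ k * v"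
    proof (rule residue_order_power[OF p emb])
      show "z \<noteq> 0 \<and> integral_over (\<iota> ` padic_integers p) z \<and>
          integral_over (\<iota> ` padic_integers p) (inverse z)" if "z \<in> lam ` {1..3}" for z
        using that lamR unit by (auto simp: R_def B_def)
    qed (use i in auto)
    then show ?thesis by (simp add: Nn_def R_def B_def)
  qed
  then obtain u where u: "\<And>i. i \<in> {1..3} \<Longrightarrow> u i \<in> R"
    "\<And>i. i \<in> {1..3} \<Longrightarrow> lam i ^ Nn = 1 + of_nat p ^ k * u i"
    by metis

  \<comment> \<open>The roots of unity live in the algebraic closure, so the congruences are set up
    in a valuation ring there.\<close>
  obtain A :: "'l alg_closure set" where A: "padic_valuation_ring_closed A p" "to_ac ` B \<subseteq> A"
    using ex_padic_valuation_ring[OF p emb] unfolding B_def by blast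
  interpret padic_valuation_ring_closed A p by (rule A(1))
  have Bac: "unital_subring (to_ac ` B)" by (rule unital_subring_to_ac[OF B])
  have RA: "to_ac z \<in> A" if "z \<in> R" for z
    using integral_over_to_ac[of B z] that A(2) valuation
      valuation_subring_integrally_closed integral_over_mono unfolding R_def by blast
  define C' where "C' = (\<lambda>i. to_ac (C i))"
  define L where "L = (\<lambda>i. to_ac (lam i))"
  define w where "w = (\<lambda>i. to_ac (u i))"
  have inA: "C' i \<in> A \<and> L i \<in> A \<and> inverse (L i) \<in> A \<and> L i \<noteq> 0 \<and> w i \<in> A" if i: "i \<in> {1..3}" for i
    using RA CR[OF i] lamR[OF i] unit[OF i] u(1)[OF i]
    by (auto simp: C'_def L_def w_def simp flip: to_ac_inverse)
  then have inA': "C' i \<in> A \<and> L i \<in> A \<and> w i \<in> A" if i: "i \<in> {1..3}" for i using that by blast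
  have Lpow: "L i ^ Nn = 1 + of_nat p ^ k * w i" if i: "i \<in> {1..3}" for i
    using arg_cong[OF u(2)[OF i], of to_ac] by (simp add: L_def w_def)

  define y where "y = (\<lambda>n. \<lfloor>x (int n)\<rfloor>)"
  have y: "x (int n) = of_int (y n)" for n
    unfolding y_def by (rule recurrence_nonneg_integral[OF rec init, symmetric]) simp
  have ysum: "of_int (y n) = (\<Sum>i\<in>{1..3}. C' i * L i ^ n)" for n
  proof -
    have "of_int (y n) = (\<Sum>i\<in>{1..3}. C i * lam i ^ n)"
      using binet[of "int n"] by (simp add: y C_def)
    then have "to_ac (of_int (y n)) = to_ac (\<Sum>i\<in>{1..3}. C i * lam i ^ n)" by simp
    then show ?thesis by (simp add: to_ac_sum C'_def L_def)
  qed
  obtain l' where l': "l = int l'" using l(1) by (metis atLeastLessThan_iff nonneg_int_cases)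
  define s where "s = y (l' + Nn) - y l'"
  have xl: "\<lfloor>x l\<rfloor> = y l'" "\<lfloor>x (l + N)\<rfloor> = y (l' + Nn)" by (simp_all add: y_def l' N)
  have pk: "int p ^ k \<noteq> 0" using p by auto
  have sdvd: "int p ^ k dvd s"
    unfolding s_def by (rule progression_step_dvd[OF inA' Lpow ysum])
  define S where "S = s div int p ^ k"
  have sS: "s = int p ^ k * S" using sdvd by (simp add: S_def)
  have affine: "int p ^ (k + m + 1) dvd y (l' + Nn * (t + r)) - y (l' + Nn * t) - int r * s"
    if "p ^ m dvd r" for m t r
    unfolding s_def by (rule progression_affine[OF k inA' Lpow ysum that])
  have ydvd: "int p ^ k dvd y (l' + Nn * t)" for t
  proof -
    \<comment> \<open>The affine congruence based at index l': both \<open>y l'\<close> and the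
      slope s are divisible by p^k, so all terms of the progression are.\<close>
    have "int p ^ k dvd y (l' + Nn * (0 + t)) - y (l' + Nn * 0) - int t * s"
      using affine[of 0 t 0] by (auto intro: dvd_trans[of _ "int p ^ (k + 0 + 1)"])
    then have "int p ^ k dvd y (l' + Nn * t) - y l' - int t * s + (y l' + int t * s)"
      using l(2) sdvd unfolding xl by (intro dvd_add) auto
    then show ?thesis by simp
  qed
  \<comment> \<open>Division by p^k leaves a function that is affine to the precision required by
    \<open>newton_zeros\<close>, with slope S prime to p.\<close>
  define f where "f = (\<lambda>t. y (l' + Nn * t) div int p ^ k)"
  have f: "y (l' + Nn * t) = int p ^ k * f t" for t using ydvd[of t] by (simp add: f_def)
  have lin: "int p ^ (m + 1) dvd f (t + r) - f t - int r * S" if "p ^ m dvd r" for m r t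
  proof -
    have "int p ^ k * int p ^ (m + 1) dvd int p ^ k * (f (t + r) - f t - int r * S)"
      using affine[OF that, of t] unfolding f sS by (simp add: algebra_simps power_add)
    then show ?thesis by (subst (asm) dvd_mult_cancel_left) (use pk in blast)
  qed
  have Snd: "\<not> int p dvd S"
  proof
    assume "int p dvd S"
    then have "int p ^ (k + 1) dvd s" unfolding sS by (simp add: mult_dvd_mono)
    then show False using l(3) unfolding xl s_def by (simp add: cong_0_iff)
  qed

  define T where "T = {int (l' + Nn * t) |t. True}"
  have "\<exists>n\<in>T. n \<ge> int m \<and> (\<exists>v. x n = of_int v \<and> int p ^ m dvd v)" for m
  proof -
    obtain t where t: "t \<ge> m" "int p ^ m dvd f t" using newton_zeros[OF p Snd lin] by blast
    have "m \<le> Nn * t" using t(1) Npos by (metis One_nat_def Suc_leI mult_le_mono nat_mult_1)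
    then have "int (l' + Nn * t) \<ge> int m" by linarith
    moreover have "int p ^ m dvd y (l' + Nn * t)" unfolding f using t(2) by simp
    ultimately show ?thesis using y[of "l' + Nn * t"] unfolding T_def by blast
  qed
  then obtain \<alpha> where \<alpha>: "\<And>m. \<exists>n\<in>T. int p ^ m dvd n - \<alpha> \<and> (\<exists>v. x n = of_int v \<and> int p ^ m dvd v)"
    using marques_lengyel_accumulation[OF p ml, of T] by blast
  have acc: "\<exists>t. int p ^ m dvd int (l' + Nn * t) - \<alpha> \<and> int p ^ m dvd y (l' + Nn * t)" for m
    using \<alpha>[of m] y unfolding T_def by (auto simp del: of_nat_add of_nat_mult)

  have "\<exists>\<xi>. (\<forall>i\<in>{1..3}. \<xi> i ^ Nn = 1) \<and>
      (\<forall>m. divisible (of_nat p ^ m) (\<Sum>i\<in>{1..3}. \<xi> i * C' i * L i powi \<alpha>))"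
  proof (rule twisted_zero_accumulation[OF k finite_atLeastAtMost Npos])
    show "\<exists>n. int p ^ m dvd y n \<and> int p ^ m dvd int n - \<alpha>" for m using acc by blast
  qed (fact inA Lpow ysum)+
  then obtain \<xi> where \<xi>: "\<And>i. i \<in> {1..3} \<Longrightarrow> \<xi> i ^ Nn = 1"
    "\<And>m. divisible (of_nat p ^ m) (\<Sum>i\<in>{1..3}. \<xi> i * C' i * L i powi \<alpha>)"
    by blast
  have "(\<Sum>i\<in>{1..3}. \<xi> i * C' i * L i powi \<alpha>) = 0"
  \<comment> \<open>Two conditions remain: nonzero p-adic integers divide powers of p, and the sum
    is integral, because the roots of unity are and so are the coefficients and the powers of the
    units \<open>lam i\<close>.\<close>
  proof (rule separated[OF A(2) _ _ \<xi>(2)])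
    fix b assume "b \<in> to_ac ` B" "b \<noteq> 0"
    then obtain b0 where b0: "b = to_ac b0" "b0 \<in> B" "b0 \<noteq> 0" by auto
    then obtain m b' where "b' \<in> B" "b0 * b' = of_nat p ^ m"
      using padic_integer_dvd_power[OF p emb] unfolding B_def by blast
    then have "to_ac b' \<in> A" "b * to_ac b' = of_nat p ^ m"
      using A(2) b0(1) by (auto simp flip: to_ac_mult)
    then show "\<exists>m. \<exists>b'\<in>A. b * b' = of_nat p ^ m" by blast
  next
    let ?R = "{z. integral_over (to_ac ` B) z}"
    note R' = unital_subring_integral_closure[OF Bac]
    have "\<xi> i \<in> ?R" if "i \<in> {1..3}" for i
      using integral_over_root_of_unity[OF Bac \<xi>(1)[OF that] Npos] by simp
    moreover have "to_ac z \<in> ?R" if "z \<in> R" for z using integral_over_to_ac that by (auto simp: R_def)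
    ultimately have "(\<Sum>i\<in>{1..3}. \<xi> i * C' i * L i powi \<alpha>) \<in> ?R"
      using CR lamR unit
      unfolding C'_def L_def
      by (intro unital_subring_sum[OF R'] unital_subringD(6)[OF R'] unital_subring_powi[OF R'])
         (auto simp flip: to_ac_inverse)
    then show "integral_over (to_ac ` B) (\<Sum>i\<in>{1..3}. \<xi> i * C' i * L i powi \<alpha>)" by simp
  qed
  then have "\<alpha> \<in> Z"
    unfolding Z_def twisted_zeros_def C'_def L_def C_def using \<xi>(1) Npos
    by (intro CollectI exI[of _ \<xi>]) auto
  \<comment> \<open>At an index l + N t close to \<alpha> whose term is divisible by p^(k+1),
    linearity gives 0 = f(0) + t S modulo p. Solving for t identifies l + N t, and with it \<alpha>,
    with the number that the hypothesis separates from all twisted zeros.\<close>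
  moreover have "[l - y l' div int p ^ k * modular_inverse (int p) S * N = \<alpha>] (mod int p)"
  proof -
    obtain t where t: "int p ^ (k + 1) dvd int (l' + Nn * t) - \<alpha>" "int p ^ (k + 1) dvd y (l' + Nn * t)"
      using acc by blast
    have "int p dvd int (l' + Nn * t) - \<alpha>"
      using t(1) by (metis dvd_trans dvd_triv_right power_add power_one_right)
    then have 1: "[int (l' + Nn * t) = \<alpha>] (mod int p)" by (simp add: cong_iff_dvd_diff)
    have "int p ^ k * int p dvd int p ^ k * f t" using t(2) unfolding f by (simp add: power_add mult.commute)
    then have "int p dvd f t" by (subst (asm) dvd_mult_cancel_left) (use pk in blast)
    moreover have "int p dvd f t - f 0 - int t * S" using lin[of 0 t 0] by simp
    ultimately have "int p dvd f t - (f t - f 0 - int t * S)" by (rule dvd_diff)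
    then have 2: "[int t * S = - f 0] (mod int p)" by (simp add: cong_iff_dvd_diff algebra_simps)
    have "coprime S (int p)"
      using Snd p prime_imp_coprime[of "int p" S] by (simp add: coprime_commute)
    then have 3: "[S * modular_inverse (int p) S = 1] (mod int p)" by (rule cong_modular_inverse1)
    have "[int t = int t * (S * modular_inverse (int p) S)] (mod int p)"
      using cong_scalar_left[OF cong_sym[OF 3], of "int t"] by simp
    also have "[int t * (S * modular_inverse (int p) S) = - f 0 * modular_inverse (int p) S] (mod int p)"
      using cong_scalar_right[OF 2, of "modular_inverse (int p) S"] by (simp add: mult.assoc)
    finally have "[int l' + int Nn * int t = int l' + int Nn * (- f 0 * modular_inverse (int p) S)] (mod int p)"
      by (intro cong_add cong_scalar_left) auto
    then have "[l - f 0 * modular_inverse (int p) S * N = int (l' + Nn * t)] (mod int p)"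
      by (simp add: l' N algebra_simps cong_sym_eq)
    then show ?thesis using 1 cong_trans by (simp add: f_def)
  qed
  ultimately show False using l(4) unfolding xl S_def s_def by blast
qed

theorem theorem1p3:
  fixes p :: nat and a b c x0 x1 x2 :: int
    and x :: "int \<Rightarrow> rat"
    and \<iota> :: "(nat \<Rightarrow> rat) set \<Rightarrow> 'l::field_char_0"
    and lam :: "nat \<Rightarrow> 'l"
  assumes "Factorial_Ring.prime p"
    and "\<not> int p dvd c"
    and "\<And>n. x n = of_int a * x (n - 1) + of_int b * x (n - 2) + of_int c * x (n - 3)"
    and "x 0 = of_int x0" and "x 1 = of_int x1" and "x 2 = of_int x2"
    and "padic_embedding p \<iota>"
    and "of_int_poly (char_poly3 a b c) = (\<Prod>i=1..3. [:- lam i, 1:])"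
    and "\<And>n. of_rat (x n) = (\<Sum>i=1..3. binet_coeff a b c x0 x1 x2 (lam i) * lam i powi n)"
    and "Factorial_Ring.irreducible (of_int_poly (char_poly3 a b c) :: rat poly)"
    and "\<not> int p dvd poly_discriminant (char_poly3 a b c)"
  defines "N \<equiv> \<lambda>k. int (residue_order p \<iota> (lam ` {1..3}) k)"
    and "Z \<equiv> twisted_zeros (\<lambda>i. binet_coeff a b c x0 x1 x2 (lam i)) lam"
  shows
    "(p = 2 \<longrightarrow>
       (\<exists>l\<in>{0..<N 2}.
          int p ^ 2 dvd \<lfloor>x l\<rfloor> \<and>
          \<not> [\<lfloor>x (l + N 2)\<rfloor> - \<lfloor>x l\<rfloor> = 0] (mod int p ^ 3) \<and>
          (\<forall>r\<in>Z. \<not> [l - (\<lfloor>x l\<rfloor> div int p ^ 2)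
                       * modular_inverse (int p) ((\<lfloor>x (l + N 2)\<rfloor> - \<lfloor>x l\<rfloor>) div int p ^ 2)
                       * N 2 = r] (mod int p))) \<longrightarrow>
       \<not> marques_lengyel p x) \<and>
     (p \<noteq> 2 \<longrightarrow>
       (\<exists>l\<in>{0..<N 1}.
          int p dvd \<lfloor>x l\<rfloor> \<and>
          \<not> [\<lfloor>x (l + N 1)\<rfloor> - \<lfloor>x l\<rfloor> = 0] (mod int p ^ 2) \<and>
          (\<forall>r\<in>Z. \<not> [l - (\<lfloor>x l\<rfloor> div int p)
                       * modular_inverse (int p) ((\<lfloor>x (l + N 1)\<rfloor> - \<lfloor>x l\<rfloor>) div int p)
                       * N 1 = r] (mod int p))) \<longrightarrow>
       \<not> marques_lengyel p x)"
proof -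
  note fails = not_marques_lengyel[OF assms(1-9,11), folded Z_def, OF fun_cong[OF N_def[THEN meta_eq_to_obj_eq]]]
  show ?thesis
  proof (intro conjI impI; elim bexE conjE)
    fix l
    assume "l \<in> {0..<N 2}" "int p ^ 2 dvd \<lfloor>x l\<rfloor>"
      "\<not> [\<lfloor>x (l + N 2)\<rfloor> - \<lfloor>x l\<rfloor> = 0] (mod int p ^ 3)"
      "\<forall>r\<in>Z. \<not> [l - (\<lfloor>x l\<rfloor> div int p ^ 2)
                       * modular_inverse (int p) ((\<lfloor>x (l + N 2)\<rfloor> - \<lfloor>x l\<rfloor>) div int p ^ 2)
                       * N 2 = r] (mod int p)"
    then show "\<not> marques_lengyel p x" by (intro fails[of 2 l]) simp_all
  next
    fix l
    assume "p \<noteq> 2" "l \<in> {0..<N 1}" "int p dvd \<lfloor>x l\<rfloor>"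
      "\<not> [\<lfloor>x (l + N 1)\<rfloor> - \<lfloor>x l\<rfloor> = 0] (mod int p ^ 2)"
      "\<forall>r\<in>Z. \<not> [l - (\<lfloor>x l\<rfloor> div int p)
                       * modular_inverse (int p) ((\<lfloor>x (l + N 1)\<rfloor> - \<lfloor>x l\<rfloor>) div int p)
                       * N 1 = r] (mod int p)"
    then show "\<not> marques_lengyel p x" by (intro fails[of 1 l]) (simp_all add: power2_eq_square)
  qed
qed

end
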